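(* Let $\alpha=(\mathcal{I}^g,\alpha^g)_{g\in\mathrm{mor}(\mathcal{G})}$ be a partial action of a groupoid $\mathcal{G}$ on an $R$-semicategory $\mathcal{C}$ such that $\mathcal{I}^g$ is $(\mathcal{L},\mathcal{R})$-associative for every $g\in\mathrm{mor}(\mathcal{G})$. Then the partial skew groupoid semicategory $\mathcal{C}\ast_\alpha\mathcal{G}$ is associative, i.e. its composition of morphisms is associative.
   Context: $R$ is a commutative ring with identity. An $R$-semicategory $\mathcal{C}$ is a semicategory (like a category, but identity morphisms are not required) whose set of morphisms ${}_y\mathcal{C}_x$ from $x$ to $y$ is an $R$-module and whose composition ${}_z\mathcal{C}_y\times{}_y\mathcal{C}_x\to{}_z\mathcal{C}_x$, $(f,g)\mapsto fg$, is $R$-bilinear; all $R$-semicategories are small, with object set $\mathcal{C}_0$. Groupoids: $\mathcal{G}$ is a small category with all morphisms invertible, $\mathrm{mor}(\mathcal{G})$ its set of morphisms, $d(g)=g^{-1}g$, $r(g)=gg^{-1}$, $\mathcal{G}_0$ the set of identities; $gh$ exists iff $d(g)=r(h)$, and $\mathcal{G}^2$ is the set of pairs $(g,h)$ such that $gh$ exists. A partial action of $\mathcal{G}$ on a set $X$ is a family $(D_g,\alpha_g)_{g\in\mathrm{mor}(\mathcal{G})}$ with $D_g\subseteq D_{r(g)}\subseteq X$ and bijections $\alpha_g:D_{g^{-1}}\to D_g$ such that $X=\bigcup_{e\in\mathcal{G}_0}D_e$, $\alpha_e=\mathrm{id}_{D_e}$ for $e\in\mathcal{G}_0$, and for all $(g,h)\in\mathcal{G}^2$: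 $\alpha_g(D_{g^{-1}}\cap D_h)=D_g\cap D_{gh}$ and $\alpha_g(\alpha_h(x))=\alpha_{gh}(x)$ for $x\in\alpha_h^{-1}(D_{g^{-1}}\cap D_h)$. One writes $gx=\alpha_g(x)$ for $x\in D_{g^{-1}}$. A collection $\mathcal{I}$ of morphisms of $\mathcal{C}$ is an ideal ($\mathcal{I}\unlhd\mathcal{C}$) if ${}_y\mathcal{I}_x={}_y\mathcal{C}_x\cap\mathcal{I}$ is an $R$-submodule of ${}_y\mathcal{C}_x$ for all $x,y$, and $gf,fh\in\mathcal{I}$ for $f\in\mathcal{I}$ and morphisms $g,h$ whenever these composites are defined. A partial action of $\mathcal{G}$ on $\mathcal{C}$ is $\alpha=(\mathcal{I}^g,\alpha^g)_{g\in\mathrm{mor}(\mathcal{G})}$ such that: (i) there is a partial action $\alpha_0=(\mathcal{C}_0^g,\alpha_0^g)_g$ of $\mathcal{G}$ on the set $\mathcal{C}_0$; (ii) for each $g$, $\mathcal{I}^g$ is a set of morphisms of $\mathcal{C}$ with ${}_a\mathcal{I}^g_b=0$ if $\{a,b\}\not\subseteq\mathcal{C}_0^g$; (iii) $\mathcal{I}^g\unlhd\mathcal{I}^{r(g)}\unlhd\mathcal{C}$ and $\alpha^g:\mathcal{I}^{g^{-1}}\to\mathcal{I}^g$ is an equivalence of $R$-semicategories with $\alpha^g(f)\in{}_{gy}\mathcal{I}^g_{gx}$ for $f\in{}_y\mathcal{I}^{g^{-1}}_x$, $x,y\in\mathcal{C}_0^{g^{-1}}$; (iv) $\alpha^e=\mathrm{id}_{\mathcal{I}^e}$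 for $e\in\mathcal{G}_0$; and for $(g,h)\in\mathcal{G}^2$, $x,y\in\mathcal{C}_0^h\cap\mathcal{C}_0^{g^{-1}}$: (v) $\alpha^{h^{-1}}({}_y\mathcal{I}^h_x\cap{}_y\mathcal{I}^{g^{-1}}_x)\subseteq{}_{h^{-1}y}\mathcal{I}^{(gh)^{-1}}_{h^{-1}x}$; (vi) $\alpha^g(\alpha^h(f))=\alpha^{gh}(f)$ for $f\in\alpha^{h^{-1}}({}_y\mathcal{I}^h_x\cap{}_y\mathcal{I}^{g^{-1}}_x)$. Each $\mathcal{I}^g$ is regarded as an $R$-semicategory with object set $\mathcal{C}_0$. For $x\in\mathcal{C}_0$ put $\mathcal{G}^x=\{g\in\mathrm{mor}(\mathcal{G})\mid x\in\mathcal{C}_0^{g^{-1}}\}$. The skew groupoid (not necessarily associative) semicategory $\mathcal{C}\ast_\alpha\mathcal{G}$ has object set $\mathcal{C}_0$ and morphisms ${}_y(\mathcal{C}\ast_\alpha\mathcal{G})_x=\bigoplus_{g\in\mathcal{G}^x}{}_y\mathcal{I}^g_{gx}$; the composition is the biadditive extension of the following rule, for $t\in\mathcal{G}^y$, $g\in\mathcal{G}^x$, $f\in{}_z\mathcal{I}^t_{ty}$, $l\in{}_y\mathcal{I}^g_{gx}$: $fl=\alpha^t(\alpha^{t^{-1}}(f)\,l)\in{}_z\mathcal{I}^{tg}_{(tg)x}$ if $(t,g)\in\mathcal{G}^2$ and $x\in\mathcal{C}_0^{(tg)^{-1}}$, and $fl=0$ otherwise. For an $R$-semicategory $\mathcal{C}$,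 $a(\mathcal{C})=\bigoplus_{x,y\in\mathcal{C}_0}{}_y\mathcal{C}_x$ is the $R$-algebra with matrix product induced by composition. A multiplier of a (possibly non-unital) ring $A$ is a pair $(L,R)$ with $L:A\to A$ a right $A$-module endomorphism and $R:A\to A$ a left $A$-module endomorphism such that $R(a)b=aL(b)$ for all $a,b\in A$. $A$ is $(\mathcal{L},\mathcal{R})$-associative if $R'\circ L=L\circ R'$ for any two multipliers $(L,R)$, $(L',R')$ of $A$. An $R$-semicategory is $(\mathcal{L},\mathcal{R})$-associative if its algebra $a(\cdot)$ is. *)

theory Defs
  imports "HOL-Algebra.Module"
begin

section \<open>Groupoids\<close>

text \<open>Small categories are given by their arrows only: \<open>src g\<close> and \<open>tgt g\<close> are the identity
  morphisms at the source and target, and \<open>gcomp g h\<close> is meaningful only if \<open>src g = tgt h\<close>.\<close>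

record 'g cat_data =
  mor :: "'g set"
  src :: "'g \<Rightarrow> 'g"
  tgt :: "'g \<Rightarrow> 'g"
  gcomp :: "'g \<Rightarrow> 'g \<Rightarrow> 'g"

definition composable :: "'g cat_data \<Rightarrow> 'g \<Rightarrow> 'g \<Rightarrow> bool" where
  "composable G g h \<longleftrightarrow> g \<in> mor G \<and> h \<in> mor G \<and> src G g = tgt G h"

definition identities :: "'g cat_data \<Rightarrow> 'g set" where
  "identities G = {e \<in> mor G. src G e = e \<and> tgt G e = e}"

locale small_category =
  fixes G :: "'g cat_data"
  assumes src_id: "g \<in> mor G \<Longrightarrow> src G g \<in> identities G"
    and tgt_id: "g \<in> mor G \<Longrightarrow> tgt G g \<in> identities G"
    and comp_mor: "composable G g h \<Longrightarrow> gcomp G g h \<in> mor G"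
    and src_comp: "composable G g h \<Longrightarrow> src G (gcomp G g h) = src G h"
    and tgt_comp: "composable G g h \<Longrightarrow> tgt G (gcomp G g h) = tgt G g"
    and comp_assoc: "\<lbrakk>composable G g h; composable G h k\<rbrakk>
        \<Longrightarrow> gcomp G (gcomp G g h) k = gcomp G g (gcomp G h k)"
    and comp_src: "g \<in> mor G \<Longrightarrow> gcomp G g (src G g) = g"
    and comp_tgt: "g \<in> mor G \<Longrightarrow> gcomp G (tgt G g) g = g"

definition is_inverse :: "'g cat_data \<Rightarrow> 'g \<Rightarrow> 'g \<Rightarrow> bool" where
  "is_inverse G g h \<longleftrightarrow> composable G h g \<and> composable G g h
     \<and> gcomp G h g = src G g \<and> gcomp G g h = tgt G g"

definition ginv :: "'g cat_data \<Rightarrow> 'g \<Rightarrow> 'g" where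
  "ginv G g = (THE h. is_inverse G g h)"

locale groupoid = small_category +
  assumes ex_inverse: "g \<in> mor G \<Longrightarrow> \<exists>h. is_inverse G g h"


section \<open>Partial actions of groupoids on sets\<close>

locale partial_action_set = groupoid G
  for G :: "'g cat_data" +
  fixes X :: "'o set"
    and D :: "'g \<Rightarrow> 'o set"
    and a :: "'g \<Rightarrow> 'o \<Rightarrow> 'o"
  assumes D_tgt: "g \<in> mor G \<Longrightarrow> D g \<subseteq> D (tgt G g)"
    and D_tgt_sub: "g \<in> mor G \<Longrightarrow> D (tgt G g) \<subseteq> X"
    and a_bij: "g \<in> mor G \<Longrightarrow> bij_betw (a g) (D (ginv G g)) (D g)"
    and D_cover: "X = (\<Union>e\<in>identities G. D e)"
    and a_id: "\<lbrakk>e \<in> identities G; x \<in> D e\<rbrakk> \<Longrightarrow> a e x = x"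
    and a_dom: "composable G g h
        \<Longrightarrow> a g ` (D (ginv G g) \<inter> D h) = D g \<inter> D (gcomp G g h)"
    and a_comp: "\<lbrakk>composable G g h; x \<in> D (ginv G h); a h x \<in> D (ginv G g) \<inter> D h\<rbrakk>
        \<Longrightarrow> a g (a h x) = a (gcomp G g h) x"


section \<open>Semicategories over a commutative ring\<close>

text \<open>\<open>Hom C y x\<close> is the module of morphisms from \<open>x\<close> to \<open>y\<close>, and \<open>Comp C z y x f l\<close> is the
  composite of \<open>l\<close> from \<open>x\<close> to \<open>y\<close> with \<open>f\<close> from \<open>y\<close> to \<open>z\<close>.  The modules \<open>Hom C y x\<close> need not be
  disjoint: a morphism is an element together with its indices.  Of the \<open>module\<close> record only
  the module fields of \<open>Hom C y x\<close> matter, its \<open>mult\<close> and \<open>one\<close> play no role.\<close>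

record ('r, 'm, 'o) semicat_data =
  Obj :: "'o set"
  Hom :: "'o \<Rightarrow> 'o \<Rightarrow> ('r, 'm) module"
  Comp :: "'o \<Rightarrow> 'o \<Rightarrow> 'o \<Rightarrow> 'm \<Rightarrow> 'm \<Rightarrow> 'm"

definition semicat_associative :: "('r, 'm, 'o) semicat_data \<Rightarrow> bool" where
  "semicat_associative C \<longleftrightarrow>
    (\<forall>w\<in>Obj C. \<forall>z\<in>Obj C. \<forall>y\<in>Obj C. \<forall>x\<in>Obj C.
     \<forall>f\<in>carrier (Hom C w z). \<forall>l\<in>carrier (Hom C z y). \<forall>h\<in>carrier (Hom C y x).
       Comp C w y x (Comp C w z y f l) h = Comp C w z x f (Comp C z y x l h))"

locale r_semicategory =
  fixes R :: "'r ring" and C :: "('r, 'm, 'o) semicat_data"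
  assumes hom_module: "\<lbrakk>y \<in> Obj C; x \<in> Obj C\<rbrakk> \<Longrightarrow> module R (Hom C y x)"
    and comp_closed:
      "\<lbrakk>z \<in> Obj C; y \<in> Obj C; x \<in> Obj C; f \<in> carrier (Hom C z y); l \<in> carrier (Hom C y x)\<rbrakk>
       \<Longrightarrow> Comp C z y x f l \<in> carrier (Hom C z x)"
    and comp_add_left:
      "\<lbrakk>z \<in> Obj C; y \<in> Obj C; x \<in> Obj C; f \<in> carrier (Hom C z y); f' \<in> carrier (Hom C z y);
        l \<in> carrier (Hom C y x)\<rbrakk>
       \<Longrightarrow> Comp C z y x (f \<oplus>\<^bsub>Hom C z y\<^esub> f') l = Comp C z y x f l \<oplus>\<^bsub>Hom C z x\<^esub> Comp C z y x f' l"
    and comp_add_right: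
      "\<lbrakk>z \<in> Obj C; y \<in> Obj C; x \<in> Obj C; f \<in> carrier (Hom C z y);
        l \<in> carrier (Hom C y x); l' \<in> carrier (Hom C y x)\<rbrakk>
       \<Longrightarrow> Comp C z y x f (l \<oplus>\<^bsub>Hom C y x\<^esub> l') = Comp C z y x f l \<oplus>\<^bsub>Hom C z x\<^esub> Comp C z y x f l'"
    and comp_smult_left:
      "\<lbrakk>z \<in> Obj C; y \<in> Obj C; x \<in> Obj C; c \<in> carrier R; f \<in> carrier (Hom C z y);
        l \<in> carrier (Hom C y x)\<rbrakk>
       \<Longrightarrow> Comp C z y x (c \<odot>\<^bsub>Hom C z y\<^esub> f) l = c \<odot>\<^bsub>Hom C z x\<^esub> Comp C z y x f l"
    and comp_smult_right:
      "\<lbrakk>z \<in> Obj C; y \<in> Obj C; x \<in> Obj C; c \<in> carrier R; f \<in> carrier (Hom C z y);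
        l \<in> carrier (Hom C y x)\<rbrakk>
       \<Longrightarrow> Comp C z y x f (c \<odot>\<^bsub>Hom C y x\<^esub> l) = c \<odot>\<^bsub>Hom C z x\<^esub> Comp C z y x f l"
    and comp_associative: "semicat_associative C"

text \<open>The semicategory with object set \<open>X\<close>, morphism modules \<open>J y x\<close> and the operations of \<open>C\<close>.\<close>

definition sub_semicat ::
  "('r, 'm, 'o) semicat_data \<Rightarrow> 'o set \<Rightarrow> ('o \<Rightarrow> 'o \<Rightarrow> 'm set) \<Rightarrow> ('r, 'm, 'o) semicat_data" where
  "sub_semicat C X J =
     \<lparr>Obj = X, Hom = (\<lambda>y x. (Hom C y x)\<lparr>carrier := J y x\<rparr>), Comp = Comp C\<rparr>"

text \<open>A collection \<open>J\<close> of morphisms is given by its parts \<open>J y x\<close> of morphisms from \<open>x\<close> to \<open>y\<close>.\<close>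

definition semicat_ideal ::
  "'r ring \<Rightarrow> ('r, 'm, 'o) semicat_data \<Rightarrow> ('o \<Rightarrow> 'o \<Rightarrow> 'm set) \<Rightarrow> bool" where
  "semicat_ideal R C J \<longleftrightarrow>
     (\<forall>y\<in>Obj C. \<forall>x\<in>Obj C. submodule (J y x) R (Hom C y x))
   \<and> (\<forall>z\<in>Obj C. \<forall>y\<in>Obj C. \<forall>x\<in>Obj C.
        (\<forall>g\<in>carrier (Hom C z y). \<forall>f\<in>J y x. Comp C z y x g f \<in> J z x)
      \<and> (\<forall>f\<in>J z y. \<forall>h\<in>carrier (Hom C y x). Comp C z y x f h \<in> J z x))"

definition r_semifunctor ::
  "'r ring \<Rightarrow> ('r, 'm, 'o) semicat_data \<Rightarrow> ('r, 'n, 'p) semicat_data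
    \<Rightarrow> ('o \<Rightarrow> 'p) \<Rightarrow> ('o \<Rightarrow> 'o \<Rightarrow> 'm \<Rightarrow> 'n) \<Rightarrow> bool" where
  "r_semifunctor R S T F0 F \<longleftrightarrow>
     F0 ` Obj S \<subseteq> Obj T
   \<and> (\<forall>y\<in>Obj S. \<forall>x\<in>Obj S.
        (\<forall>f\<in>carrier (Hom S y x). F y x f \<in> carrier (Hom T (F0 y) (F0 x)))
      \<and> (\<forall>f\<in>carrier (Hom S y x). \<forall>f'\<in>carrier (Hom S y x).
           F y x (f \<oplus>\<^bsub>Hom S y x\<^esub> f') = F y x f \<oplus>\<^bsub>Hom T (F0 y) (F0 x)\<^esub> F y x f')
      \<and> (\<forall>c\<in>carrier R. \<forall>f\<in>carrier (Hom S y x).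
           F y x (c \<odot>\<^bsub>Hom S y x\<^esub> f) = c \<odot>\<^bsub>Hom T (F0 y) (F0 x)\<^esub> F y x f))
   \<and> (\<forall>z\<in>Obj S. \<forall>y\<in>Obj S. \<forall>x\<in>Obj S. \<forall>f\<in>carrier (Hom S z y). \<forall>l\<in>carrier (Hom S y x).
        F z x (Comp S z y x f l) = Comp T (F0 z) (F0 y) (F0 x) (F z y f) (F y x l))"

text \<open>Equivalence: fully faithful and bijective on objects.  Without identities there are no
  isomorphisms of objects, so essential surjectivity is not available; in the partial actions
  below the object map is a bijection anyway.\<close>

definition r_equivalence ::
  "'r ring \<Rightarrow> ('r, 'm, 'o) semicat_data \<Rightarrow> ('r, 'n, 'p) semicat_data
    \<Rightarrow> ('o \<Rightarrow> 'p) \<Rightarrow> ('o \<Rightarrow> 'o \<Rightarrow> 'm \<Rightarrow> 'n) \<Rightarrow> bool" where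
  "r_equivalence R S T F0 F \<longleftrightarrow>
     r_semifunctor R S T F0 F
   \<and> bij_betw F0 (Obj S) (Obj T)
   \<and> (\<forall>y\<in>Obj S. \<forall>x\<in>Obj S.
        bij_betw (F y x) (carrier (Hom S y x)) (carrier (Hom T (F0 y) (F0 x))))"


section \<open>Partial actions of groupoids on semicategories\<close>

text \<open>\<open>ob_dom A g\<close> and \<open>ob_act A g\<close> form the partial action on objects, \<open>Idl A g y x\<close> is the part
  from \<open>x\<close> to \<open>y\<close> of the ideal at \<open>g\<close>, and \<open>act A g y x\<close> is the action of \<open>g\<close> on \<open>Idl A (ginv G g) y x\<close>.\<close>

record ('m, 'o, 'g) pact_data =
  ob_dom :: "'g \<Rightarrow> 'o set"
  ob_act :: "'g \<Rightarrow> 'o \<Rightarrow> 'o"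
  Idl :: "'g \<Rightarrow> 'o \<Rightarrow> 'o \<Rightarrow> 'm set"
  act :: "'g \<Rightarrow> 'o \<Rightarrow> 'o \<Rightarrow> 'm \<Rightarrow> 'm"

definition ideal_semicat ::
  "('r, 'm, 'o) semicat_data \<Rightarrow> ('m, 'o, 'g) pact_data \<Rightarrow> 'g \<Rightarrow> ('r, 'm, 'o) semicat_data" where
  "ideal_semicat C A g = sub_semicat C (Obj C) (Idl A g)"

text \<open>By \<open>Idl_zero\<close> the ideals vanish off \<open>ob_dom A\<close>, where the object map is not defined; the
  equivalence is therefore stated on the objects \<open>ob_dom A (ginv G g)\<close> and \<open>ob_dom A g\<close>.\<close>

locale partial_action_semicat =
  groupoid G + r_semicategory R C + partial_action_set G "Obj C" "ob_dom A" "ob_act A"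
  for R :: "'r ring" and C :: "('r, 'm, 'o) semicat_data"
    and G :: "'g cat_data" and A :: "('m, 'o, 'g) pact_data" +
  assumes Idl_zero:
      "\<lbrakk>g \<in> mor G; y \<in> Obj C; x \<in> Obj C; \<not> {y, x} \<subseteq> ob_dom A g\<rbrakk>
       \<Longrightarrow> Idl A g y x = {\<zero>\<^bsub>Hom C y x\<^esub>}"
    and Idl_ideal: "g \<in> mor G \<Longrightarrow> semicat_ideal R (ideal_semicat C A (tgt G g)) (Idl A g)"
    and Idl_tgt_ideal: "g \<in> mor G \<Longrightarrow> semicat_ideal R C (Idl A (tgt G g))"
    and act_equivalence:
      "g \<in> mor G \<Longrightarrow>
         r_equivalence R (sub_semicat C (ob_dom A (ginv G g)) (Idl A (ginv G g)))
           (sub_semicat C (ob_dom A g) (Idl A g)) (ob_act A g) (act A g)"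
    and act_id:
      "\<lbrakk>e \<in> identities G; y \<in> ob_dom A e; x \<in> ob_dom A e; f \<in> Idl A e y x\<rbrakk> \<Longrightarrow> act A e y x f = f"
    and act_dom:
      "\<lbrakk>composable G g h; x \<in> ob_dom A h \<inter> ob_dom A (ginv G g);
        y \<in> ob_dom A h \<inter> ob_dom A (ginv G g)\<rbrakk>
       \<Longrightarrow> act A (ginv G h) y x ` (Idl A h y x \<inter> Idl A (ginv G g) y x)
           \<subseteq> Idl A (ginv G (gcomp G g h)) (ob_act A (ginv G h) y) (ob_act A (ginv G h) x)"
    and act_comp:
      "\<lbrakk>composable G g h; x \<in> ob_dom A h \<inter> ob_dom A (ginv G g);
        y \<in> ob_dom A h \<inter> ob_dom A (ginv G g);
        y' = ob_act A (ginv G h) y; x' = ob_act A (ginv G h) x;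
        f \<in> act A (ginv G h) y x ` (Idl A h y x \<inter> Idl A (ginv G g) y x)\<rbrakk>
       \<Longrightarrow> act A g y x (act A h y' x' f) = act A (gcomp G g h) y' x' f"


section \<open>The skew groupoid semicategory\<close>

text \<open>Elements of a direct sum are extensional families with finite support; \<open>mult\<close> and \<open>one\<close>
  are irrelevant fillers.\<close>

definition direct_sum :: "'i set \<Rightarrow> ('i \<Rightarrow> ('r, 'm) module) \<Rightarrow> ('r, 'i \<Rightarrow> 'm) module" where
  "direct_sum I M =
     \<lparr>carrier = {u \<in> \<Pi>\<^sub>E i\<in>I. carrier (M i). finite {i \<in> I. u i \<noteq> \<zero>\<^bsub>M i\<^esub>}},
      mult = undefined, one = undefined,
      zero = (\<lambda>i\<in>I. \<zero>\<^bsub>M i\<^esub>),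
      add = (\<lambda>u v. \<lambda>i\<in>I. u i \<oplus>\<^bsub>M i\<^esub> v i),
      smult = (\<lambda>c u. \<lambda>i\<in>I. c \<odot>\<^bsub>M i\<^esub> u i)\<rparr>"

definition ds_incl :: "'i set \<Rightarrow> ('i \<Rightarrow> ('r, 'm) module) \<Rightarrow> 'i \<Rightarrow> 'm \<Rightarrow> 'i \<Rightarrow> 'm" where
  "ds_incl I M i m = (\<lambda>j\<in>I. if j = i then m else \<zero>\<^bsub>M j\<^esub>)"

definition ds_support :: "'i set \<Rightarrow> ('i \<Rightarrow> ('r, 'm) module) \<Rightarrow> ('i \<Rightarrow> 'm) \<Rightarrow> 'i set" where
  "ds_support I M u = {i \<in> I. u i \<noteq> \<zero>\<^bsub>M i\<^esub>}"

text \<open>The morphisms of \<open>G\<close> acting on the object \<open>x\<close>.\<close>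

definition star :: "'g cat_data \<Rightarrow> ('m, 'o, 'g) pact_data \<Rightarrow> 'o \<Rightarrow> 'g set" where
  "star G A x = {g \<in> mor G. x \<in> ob_dom A (ginv G g)}"

definition skew_summand ::
  "('r, 'm, 'o) semicat_data \<Rightarrow> ('m, 'o, 'g) pact_data \<Rightarrow> 'o \<Rightarrow> 'o \<Rightarrow> 'g \<Rightarrow> ('r, 'm) module" where
  "skew_summand C A y x g = Hom (ideal_semicat C A g) y (ob_act A g x)"

definition skew_hom ::
  "('r, 'm, 'o) semicat_data \<Rightarrow> 'g cat_data \<Rightarrow> ('m, 'o, 'g) pact_data \<Rightarrow> 'o \<Rightarrow> 'o
    \<Rightarrow> ('r, 'g \<Rightarrow> 'm) module" where
  "skew_hom C G A y x = direct_sum (star G A x) (skew_summand C A y x)"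

text \<open>The product of \<open>f\<close> in the \<open>t\<close>-summand of the morphisms from \<open>y\<close> to \<open>z\<close> and \<open>l\<close> in the
  \<open>g\<close>-summand of the morphisms from \<open>x\<close> to \<open>y\<close>.  The guard \<open>z \<in> ob_dom A t\<close> loses nothing: if it
  fails, then \<open>f\<close> is zero by \<open>Idl_zero\<close>, and \<open>ob_act A (ginv G t) z\<close> is not defined.\<close>

definition skew_comp_hom ::
  "('r, 'm, 'o) semicat_data \<Rightarrow> 'g cat_data \<Rightarrow> ('m, 'o, 'g) pact_data \<Rightarrow> 'o \<Rightarrow> 'o \<Rightarrow> 'o
    \<Rightarrow> 'g \<Rightarrow> 'g \<Rightarrow> 'm \<Rightarrow> 'm \<Rightarrow> 'g \<Rightarrow> 'm" where
  "skew_comp_hom C G A z y x t g f l =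
     (if composable G t g \<and> x \<in> ob_dom A (ginv G (gcomp G t g)) \<and> z \<in> ob_dom A t
      then let z' = ob_act A (ginv G t) z; x' = ob_act A g x in
        ds_incl (star G A x) (skew_summand C A z x) (gcomp G t g)
          (act A t z' x' (Comp C z' y x' (act A (ginv G t) z (ob_act A t y) f) l))
      else \<zero>\<^bsub>skew_hom C G A z x\<^esub>)"

definition skew_semicat ::
  "('r, 'm, 'o) semicat_data \<Rightarrow> 'g cat_data \<Rightarrow> ('m, 'o, 'g) pact_data
    \<Rightarrow> ('r, 'g \<Rightarrow> 'm, 'o) semicat_data" where
  "skew_semicat C G A =
     \<lparr>Obj = Obj C,
      Hom = skew_hom C G A,
      Comp = (\<lambda>z y x u v.
        finsum (skew_hom C G A z x)
          (\<lambda>(t, g). skew_comp_hom C G A z y x t g (u t) (v g))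
          (ds_support (star G A y) (skew_summand C A z y) u
            \<times> ds_support (star G A x) (skew_summand C A y x) v))\<rparr>"


section \<open>Multipliers and associativity\<close>

text \<open>The algebra of a semicategory: matrices with entry \<open>M (y, x)\<close> in \<open>Hom C y x\<close>, almost all
  zero.  The sum in the matrix product runs over the finitely many indices at which both factors
  are nonzero, since \<open>finsum\<close> over an infinite set is zero by convention.\<close>

definition semicat_algebra ::
  "('r, 'm, 'o) semicat_data \<Rightarrow> ('r, 'o \<times> 'o \<Rightarrow> 'm) module" where
  "semicat_algebra C =
     (direct_sum (Obj C \<times> Obj C) (\<lambda>(y, x). Hom C y x))
       \<lparr>mult := (\<lambda>M N. \<lambda>(z, x)\<in>Obj C \<times> Obj C.
          \<Oplus>\<^bsub>Hom C z x\<^esub> y \<in> {y \<in> Obj C. M (z, y) \<noteq> \<zero>\<^bsub>Hom C z y\<^esub> \<and> N (y, x) \<noteq> \<zero>\<^bsub>Hom C y x\<^esub>}.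
            Comp C z y x (M (z, y)) (N (y, x)))\<rparr>"

definition multiplier :: "('a, 'b) ring_scheme \<Rightarrow> ('a \<Rightarrow> 'a) \<Rightarrow> ('a \<Rightarrow> 'a) \<Rightarrow> bool" where
  "multiplier A L R \<longleftrightarrow>
     L \<in> hom (add_monoid A) (add_monoid A) \<and> R \<in> hom (add_monoid A) (add_monoid A)
   \<and> (\<forall>a\<in>carrier A. \<forall>b\<in>carrier A.
        L (a \<otimes>\<^bsub>A\<^esub> b) = L a \<otimes>\<^bsub>A\<^esub> b
      \<and> R (a \<otimes>\<^bsub>A\<^esub> b) = a \<otimes>\<^bsub>A\<^esub> R b
      \<and> R a \<otimes>\<^bsub>A\<^esub> b = a \<otimes>\<^bsub>A\<^esub> L b)"

definition LR_associative_ring :: "('a, 'b) ring_scheme \<Rightarrow> bool" where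
  "LR_associative_ring A \<longleftrightarrow>
     (\<forall>L R L' R'. multiplier A L R \<and> multiplier A L' R' \<longrightarrow>
        (\<forall>a\<in>carrier A. R' (L a) = L (R' a)))"

definition LR_associative :: "('r, 'm, 'o) semicat_data \<Rightarrow> bool" where
  "LR_associative C \<longleftrightarrow> LR_associative_ring (semicat_algebra C)"

end

theory Submission
  imports Defs
begin

text \<open>By biadditivity it suffices to compare \<open>(f l) h\<close> and \<open>f (l h)\<close> for homogeneous \<open>f\<close>, \<open>l\<close>,
  \<open>h\<close> in the summands at \<open>s\<close>, \<open>t\<close>, \<open>g\<close>.  Write \<open>a\<^sub>t\<close> for the action of \<open>t\<close>, \<open>b\<^sub>t\<close> for its inverse,
  and put \<open>f' = b\<^sub>s f\<close>.  When everything is defined, compatibility of the action with composites gives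
    \<open>(f l) h = a\<^sub>s (a\<^sub>t (b\<^sub>t (f' l) h))\<close>  and  \<open>f (l h) = a\<^sub>s (f' (a\<^sub>t (b\<^sub>t l h)))\<close>,
  so the claim is that left multiplication by \<open>f'\<close> commutes with the operation \<open>a\<^sub>t (b\<^sub>t _ h)\<close> on
  the ideal at \<open>t\<close>.  Both are halves of multipliers of that ideal: \<open>f'\<close> lies in the ideal at the
  target of \<open>t\<close>, of which the ideal at \<open>t\<close> is an ideal, and the second operation is right
  multiplication by \<open>h\<close> on the ideal at the inverse of \<open>t\<close>, carried over by the isomorphism \<open>a\<^sub>t\<close>.
  Hence they commute by the \<open>(L,R)\<close>-associativity of the ideal at \<open>t\<close>; this is \<open>conj_right_comp\<close>.

  That property speaks of matrices, whereas \<open>f'\<close> and \<open>h\<close> sit at single pairs of objects.  The locale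
  \<open>entry_multiplier\<close> isolates what a single morphism has to satisfy to act on all matrices, by moving
  one row to another row and one column to another column, and
  \<open>LR_associative_entry_multipliers\<close> brings the commutation back to single morphisms.

  There remain the cases in which only one of the two iterated products is declared to be zero.  Then
  some object lies outside the domain on which the morphisms of an ideal can be nonzero, and this makes
  the other product vanish too (\<open>skew_comp_assoc_homogeneous\<close>).\<close>


section \<open>Inverses in a groupoid\<close>

context groupoid
begin

lemma inverse_unique:
  assumes "is_inverse G g h" "is_inverse G g k"
  shows "h = k"
proof -
  have c: "composable G h g" "composable G g k" "composable G g h" "composable G k g"
    using assms by (auto simp: is_inverse_def)
  have "h = gcomp G h (src G h)"
    using c(1) comp_src[of h] by (simp add: composable_def)
  also have "\<dots> = gcomp G h (gcomp G g k)"
    using assms c by (simp add: is_inverse_def composable_def)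
  also have "\<dots> = gcomp G (gcomp G h g) k"
    using comp_assoc[OF c(1,2)] by simp
  also have "\<dots> = gcomp G (tgt G k) k"
    using assms c by (simp add: is_inverse_def composable_def)
  also have "\<dots> = k"
    using c comp_tgt[of k] by (simp add: composable_def)
  finally show ?thesis .
qed

lemma ginv_eqI: "is_inverse G g h \<Longrightarrow> ginv G g = h"
  unfolding ginv_def by (rule the_equality) (auto intro: inverse_unique)

lemma is_inverse_ginv: "g \<in> mor G \<Longrightarrow> is_inverse G g (ginv G g)"
  using ex_inverse ginv_eqI by metis

lemma ginv_simps:
  assumes "g \<in> mor G"
  shows "ginv G g \<in> mor G" "src G (ginv G g) = tgt G g" "tgt G (ginv G g) = src G g"
    "gcomp G (ginv G g) g = src G g" "gcomp G g (ginv G g) = tgt G g"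
  using is_inverse_ginv[OF assms] by (auto simp: is_inverse_def composable_def)

lemma ginv_ginv: "g \<in> mor G \<Longrightarrow> ginv G (ginv G g) = g"
  using is_inverse_ginv ginv_simps(1-3) by (auto intro!: ginv_eqI simp: is_inverse_def)

lemma composable_ginv_ginv:
  "composable G g h \<Longrightarrow> composable G (ginv G h) (ginv G g)"
  by (simp add: composable_def ginv_simps)

lemma composable_ginv_comp:
  "composable G g h \<Longrightarrow> composable G (ginv G g) (gcomp G g h)"
  using comp_mor tgt_comp by (simp add: composable_def ginv_simps)

lemma composable_comp_ginv:
  "composable G g h \<Longrightarrow> composable G (gcomp G g h) (ginv G h)"
  using comp_mor src_comp by (simp add: composable_def ginv_simps)

lemma ginv_comp_cancel:
  assumes "composable G g h"
  shows "gcomp G (ginv G g) (gcomp G g h) = h"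
proof -
  have g: "g \<in> mor G" "h \<in> mor G" "src G g = tgt G h"
    using assms by (auto simp: composable_def)
  then have "composable G (ginv G g) g"
    by (simp add: composable_def ginv_simps)
  from comp_assoc[OF this assms] g comp_tgt[of h] show ?thesis
    by (simp add: ginv_simps)
qed

lemma comp_ginv_cancel:
  assumes "composable G g h"
  shows "gcomp G (gcomp G g h) (ginv G h) = g"
proof -
  have g: "g \<in> mor G" "h \<in> mor G" "src G g = tgt G h"
    using assms by (auto simp: composable_def)
  then have "composable G h (ginv G h)"
    by (simp add: composable_def ginv_simps)
  from comp_assoc[OF assms this] g comp_src[of g] show ?thesis
    by (simp add: ginv_simps)
qed

lemma ginv_gcomp:
  assumes "composable G g h"
  shows "ginv G (gcomp G g h) = gcomp G (ginv G h) (ginv G g)"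
proof (rule ginv_eqI)
  let ?k = "gcomp G g h" and ?l = "gcomp G (ginv G h) (ginv G g)"
  have g: "g \<in> mor G" "h \<in> mor G" "src G g = tgt G h"
    using assms by (auto simp: composable_def)
  have k: "?k \<in> mor G" "src G ?k = src G h" "tgt G ?k = tgt G g"
    using assms comp_mor src_comp tgt_comp by auto
  have l: "?l \<in> mor G" "src G ?l = tgt G g" "tgt G ?l = src G h"
    using composable_ginv_ginv[OF assms] comp_mor src_comp tgt_comp g by (auto simp: ginv_simps)
  have "gcomp G ?l ?k = gcomp G (ginv G h) (gcomp G (ginv G g) ?k)"
    by (rule comp_assoc[OF composable_ginv_ginv[OF assms] composable_ginv_comp[OF assms]])
  also have "\<dots> = src G h"
    using ginv_comp_cancel[OF assms] g by (simp add: ginv_simps)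
  finally have lk: "gcomp G ?l ?k = src G h" .
  have "gcomp G ?k ?l = gcomp G (gcomp G ?k (ginv G h)) (ginv G g)"
    by (rule comp_assoc[OF composable_comp_ginv[OF assms] composable_ginv_ginv[OF assms], symmetric])
  also have "\<dots> = tgt G g"
    using comp_ginv_cancel[OF assms] g by (simp add: ginv_simps)
  finally show "is_inverse G ?k ?l"
    using k l lk by (simp add: is_inverse_def composable_def)
qed

lemma composable_assoc:
  "composable G s t \<Longrightarrow> composable G (gcomp G s t) g \<longleftrightarrow> composable G t g"
  "composable G t g \<Longrightarrow> composable G s (gcomp G t g) \<longleftrightarrow> composable G s t"
  using comp_mor src_comp tgt_comp by (auto simp: composable_def)

end


section \<open>Partial actions on sets\<close>

context partial_action_set
begin

lemma dom_subset: "g \<in> mor G \<Longrightarrow> D g \<subseteq> X"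
  using D_tgt D_tgt_sub by blast

lemma point_in_dom: "\<lbrakk>g \<in> mor G; x \<in> D (ginv G g)\<rbrakk> \<Longrightarrow> a g x \<in> D g"
  using a_bij bij_betwE by metis

lemma point_inv_in_dom: "\<lbrakk>g \<in> mor G; x \<in> D g\<rbrakk> \<Longrightarrow> a (ginv G g) x \<in> D (ginv G g)"
  using point_in_dom[of "ginv G g" x] by (simp add: ginv_simps ginv_ginv)

lemma point_inv_cancel:
  assumes "g \<in> mor G" "x \<in> D (ginv G g)"
  shows "a (ginv G g) (a g x) = x"
proof -
  have c: "composable G (ginv G g) g"
    using assms by (simp add: composable_def ginv_simps)
  have "a (ginv G g) (a g x) = a (src G g) x"
    using a_comp[OF c] assms point_in_dom by (simp add: ginv_simps ginv_ginv)
  moreover have "x \<in> D (src G g)"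
    using D_tgt[of "ginv G g"] assms by (auto simp: ginv_simps)
  ultimately show ?thesis
    using a_id src_id assms by simp
qed

lemma point_cancel_inv:
  assumes "g \<in> mor G" "x \<in> D g"
  shows "a g (a (ginv G g) x) = x"
  using point_inv_cancel[of "ginv G g" x] assms by (simp add: ginv_simps ginv_ginv)

text \<open>This is \<open>a_dom\<close> for \<open>h\<close> and the inverse of \<open>g h\<close>, whose composite is the inverse of \<open>g\<close>, together
  with the injectivity of \<open>a h\<close>.\<close>

lemma point_in_dom_iff:
  assumes "composable G g h" "x \<in> D (ginv G h)"
  shows "a h x \<in> D (ginv G g) \<longleftrightarrow> x \<in> D (ginv G (gcomp G g h))"
proof -
  have g: "g \<in> mor G" "h \<in> mor G" using assms by (auto simp: composable_def)
  have c: "composable G h (ginv G (gcomp G g h))"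
    using assms g comp_mor[OF assms(1)] tgt_comp[OF assms(1)] src_comp[OF assms(1)]
    by (simp add: composable_def ginv_simps)
  have e: "gcomp G h (ginv G (gcomp G g h)) = ginv G g"
    using ginv_comp_cancel[OF composable_ginv_ginv[OF assms(1)]] g
    by (simp add: ginv_gcomp[OF assms(1)] ginv_ginv)
  have i: "a h ` (D (ginv G h) \<inter> D (ginv G (gcomp G g h))) = D h \<inter> D (ginv G g)"
    using a_dom[OF c] e by simp
  have inj: "inj_on (a h) (D (ginv G h))"
    using a_bij g bij_betw_def by blast
  show ?thesis
  proof
    assume "a h x \<in> D (ginv G g)"
    then have "a h x \<in> a h ` (D (ginv G h) \<inter> D (ginv G (gcomp G g h)))"
      using i point_in_dom g assms by blast
    then show "x \<in> D (ginv G (gcomp G g h))"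
      using inj assms(2) by (auto dest: inj_onD)
  qed (use i assms in blast)
qed

lemma point_inv_in_dom_iff:
  assumes "composable G g h" "x \<in> D g"
  shows "a (ginv G g) x \<in> D h \<longleftrightarrow> x \<in> D (gcomp G g h)"
proof -
  have g: "g \<in> mor G" "h \<in> mor G" using assms by (auto simp: composable_def)
  show ?thesis
    using point_in_dom_iff[OF composable_ginv_ginv[OF assms(1)], of x] g assms comp_mor
      ginv_gcomp[OF assms(1), symmetric] by (simp add: ginv_ginv)
qed

lemma point_comp:
  assumes "composable G g h" "x \<in> D (ginv G h)" "a h x \<in> D (ginv G g)"
  shows "a g (a h x) = a (gcomp G g h) x"
  using a_comp assms point_in_dom by (simp add: composable_def)

end


section \<open>Additive maps and direct sums\<close>

definition additive_maps ::
  "('a, 'm) ring_scheme \<Rightarrow> ('b, 'n) ring_scheme \<Rightarrow> ('a \<Rightarrow> 'b) set" where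
  "additive_maps H K = hom (add_monoid H) (add_monoid K)"

lemma additive_zero:
  assumes "abelian_group H" "abelian_group K" "F \<in> additive_maps H K"
  shows "F \<zero>\<^bsub>H\<^esub> = \<zero>\<^bsub>K\<^esub>"
proof -
  interpret group_hom "add_monoid H" "add_monoid K" F
    using assms unfolding additive_maps_def
    by (intro group_hom.intro group_hom_axioms.intro abelian_group.a_group)
  show ?thesis using hom_one by simp
qed

lemma additive_finsum:
  assumes "abelian_group H" "abelian_group K" "F \<in> additive_maps H K"
    and "finite B" "f \<in> B \<rightarrow> carrier H"
  shows "F (finsum H f B) = finsum K (\<lambda>i. F (f i)) B"
  using assms(4,5)
proof (induction B)
  case empty
  interpret H: abelian_group H by fact
  interpret K: abelian_group K by fact
  show ?case using additive_zero[OF assms(1-3)] by simp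
next
  case (insert i B)
  interpret H: abelian_group H by fact
  interpret K: abelian_group K by fact
  have F: "F x \<in> carrier K" if "x \<in> carrier H" for x
    using assms(3) that by (auto simp: additive_maps_def hom_def)
  have "F (finsum H f (insert i B)) = F (f i) \<oplus>\<^bsub>K\<^esub> F (finsum H f B)"
    using insert assms(3) by (simp add: Pi_def additive_maps_def hom_def)
  then show ?case using insert F by (simp add: Pi_def)
qed

lemma (in abelian_monoid) finsum_superset:
  assumes "finite B" "A \<subseteq> B" "f \<in> B \<rightarrow> carrier G" "\<And>i. i \<in> B - A \<Longrightarrow> f i = \<zero>"
  shows "finsum G f A = finsum G f B"
  by (rule add.finprod_mono_neutral_cong_left) (use assms in auto)

lemma direct_sum_simps:
  "zero (direct_sum I M) = (\<lambda>i\<in>I. \<zero>\<^bsub>M i\<^esub>)"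
  "u \<oplus>\<^bsub>direct_sum I M\<^esub> v = (\<lambda>i\<in>I. u i \<oplus>\<^bsub>M i\<^esub> v i)"
  by (simp_all add: direct_sum_def)

lemma direct_sum_carrier:
  "u \<in> carrier (direct_sum I M) \<longleftrightarrow>
     u \<in> extensional I \<and> (\<forall>i\<in>I. u i \<in> carrier (M i)) \<and> finite {i \<in> I. u i \<noteq> \<zero>\<^bsub>M i\<^esub>}"
  by (auto simp: direct_sum_def PiE_def Pi_def)

lemma direct_sum_group:
  assumes "\<And>i. i \<in> I \<Longrightarrow> abelian_group (M i)"
  shows "abelian_group (direct_sum I M)"
proof (rule abelian_groupI)
  note G = abelian_groupE[OF assms]
  show z: "\<zero>\<^bsub>direct_sum I M\<^esub> \<in> carrier (direct_sum I M)"
    using G(2) by (auto simp: direct_sum_carrier direct_sum_simps)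
  fix u assume u: "u \<in> carrier (direct_sum I M)"
  then have ui: "u i \<in> carrier (M i)" if "i \<in> I" for i
    using that by (auto simp: direct_sum_carrier)
  show "\<zero>\<^bsub>direct_sum I M\<^esub> \<oplus>\<^bsub>direct_sum I M\<^esub> u = u"
    using u G(5) by (auto simp: direct_sum_carrier direct_sum_simps fun_eq_iff extensional_def)
  have neg: "\<ominus>\<^bsub>M i\<^esub> u i \<in> carrier (M i)" "(\<ominus>\<^bsub>M i\<^esub> u i) \<oplus>\<^bsub>M i\<^esub> u i = \<zero>\<^bsub>M i\<^esub>"
    "u i = \<zero>\<^bsub>M i\<^esub> \<Longrightarrow> \<ominus>\<^bsub>M i\<^esub> u i = \<zero>\<^bsub>M i\<^esub>"
    if "i \<in> I" for i
  proof -
    interpret abelian_group "M i" using assms that .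
    show "\<ominus>\<^bsub>M i\<^esub> u i \<in> carrier (M i)" "(\<ominus>\<^bsub>M i\<^esub> u i) \<oplus>\<^bsub>M i\<^esub> u i = \<zero>\<^bsub>M i\<^esub>"
      "u i = \<zero>\<^bsub>M i\<^esub> \<Longrightarrow> \<ominus>\<^bsub>M i\<^esub> u i = \<zero>\<^bsub>M i\<^esub>"
      using ui[OF that] by (auto simp: l_neg)
  qed
  have "{i \<in> I. \<ominus>\<^bsub>M i\<^esub> u i \<noteq> \<zero>\<^bsub>M i\<^esub>} \<subseteq> {i \<in> I. u i \<noteq> \<zero>\<^bsub>M i\<^esub>}"
    using neg(3) by blast
  from finite_subset[OF this] u have "finite {i \<in> I. \<ominus>\<^bsub>M i\<^esub> u i \<noteq> \<zero>\<^bsub>M i\<^esub>}"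
    by (simp add: direct_sum_carrier)
  then have "finite {i \<in> I. (\<lambda>j\<in>I. \<ominus>\<^bsub>M j\<^esub> u j) i \<noteq> \<zero>\<^bsub>M i\<^esub>}"
    by (rule rev_finite_subset) auto
  then have "(\<lambda>i\<in>I. \<ominus>\<^bsub>M i\<^esub> u i) \<in> carrier (direct_sum I M)"
    using neg(1) by (simp add: direct_sum_carrier)
  moreover have "(\<lambda>i\<in>I. \<ominus>\<^bsub>M i\<^esub> u i) \<oplus>\<^bsub>direct_sum I M\<^esub> u = \<zero>\<^bsub>direct_sum I M\<^esub>"
    using neg(2) by (auto simp: direct_sum_simps)
  ultimately show "\<exists>v\<in>carrier (direct_sum I M). v \<oplus>\<^bsub>direct_sum I M\<^esub> u = \<zero>\<^bsub>direct_sum I M\<^esub>"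
    by blast
  fix v assume v: "v \<in> carrier (direct_sum I M)"
  then have vi: "v i \<in> carrier (M i)" if "i \<in> I" for i
    using that by (auto simp: direct_sum_carrier)
  have "u i \<oplus>\<^bsub>M i\<^esub> v i = \<zero>\<^bsub>M i\<^esub>" if "i \<in> I" "u i = \<zero>\<^bsub>M i\<^esub>" "v i = \<zero>\<^bsub>M i\<^esub>" for i
    using that G(2,5) by simp
  then have "{i \<in> I. u i \<oplus>\<^bsub>M i\<^esub> v i \<noteq> \<zero>\<^bsub>M i\<^esub>}
      \<subseteq> {i \<in> I. u i \<noteq> \<zero>\<^bsub>M i\<^esub>} \<union> {i \<in> I. v i \<noteq> \<zero>\<^bsub>M i\<^esub>}"
    by blast
  from finite_subset[OF this] u v have "finite {i \<in> I. u i \<oplus>\<^bsub>M i\<^esub> v i \<noteq> \<zero>\<^bsub>M i\<^esub>}"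
    by (simp add: direct_sum_carrier)
  then have "finite {i \<in> I. (\<lambda>j\<in>I. u j \<oplus>\<^bsub>M j\<^esub> v j) i \<noteq> \<zero>\<^bsub>M i\<^esub>}"
    by (rule rev_finite_subset) auto
  then show "u \<oplus>\<^bsub>direct_sum I M\<^esub> v \<in> carrier (direct_sum I M)"
    using G(1) ui vi by (simp add: direct_sum_carrier direct_sum_simps)
  show "u \<oplus>\<^bsub>direct_sum I M\<^esub> v = v \<oplus>\<^bsub>direct_sum I M\<^esub> u"
    using G(4) ui vi by (auto simp: direct_sum_simps)
  fix w assume w: "w \<in> carrier (direct_sum I M)"
  then have wi: "w i \<in> carrier (M i)" if "i \<in> I" for i
    using that by (auto simp: direct_sum_carrier)
  show "u \<oplus>\<^bsub>direct_sum I M\<^esub> v \<oplus>\<^bsub>direct_sum I M\<^esub> w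
      = u \<oplus>\<^bsub>direct_sum I M\<^esub> (v \<oplus>\<^bsub>direct_sum I M\<^esub> w)"
    using G(3) ui vi wi by (auto simp: direct_sum_simps)
qed

lemma ds_incl_closed:
  assumes "\<And>i. i \<in> I \<Longrightarrow> abelian_group (M i)" "m \<in> carrier (M i)"
  shows "ds_incl I M i m \<in> carrier (direct_sum I M)"
proof -
  have "finite {j \<in> I. ds_incl I M i m j \<noteq> \<zero>\<^bsub>M j\<^esub>}"
    by (rule finite_subset[of _ "{i}"]) (auto simp: ds_incl_def)
  then show ?thesis
    using abelian_groupE(2)[OF assms(1)] assms(2) by (auto simp: direct_sum_carrier ds_incl_def)
qed

lemma ds_incl_zero: "ds_incl I M i \<zero>\<^bsub>M i\<^esub> = \<zero>\<^bsub>direct_sum I M\<^esub>"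
  by (auto simp: ds_incl_def direct_sum_simps)

lemma ds_incl_additive:
  assumes "\<And>i. i \<in> I \<Longrightarrow> abelian_group (M i)" "m \<in> carrier (M i)" "n \<in> carrier (M i)"
  shows "ds_incl I M i (m \<oplus>\<^bsub>M i\<^esub> n) = ds_incl I M i m \<oplus>\<^bsub>direct_sum I M\<^esub> ds_incl I M i n"
proof -
  have "\<zero>\<^bsub>M j\<^esub> = \<zero>\<^bsub>M j\<^esub> \<oplus>\<^bsub>M j\<^esub> \<zero>\<^bsub>M j\<^esub>" if "j \<in> I" for j
    using abelian_groupE(2,5)[OF assms(1)] that by simp
  then show ?thesis by (auto simp: ds_incl_def direct_sum_simps)
qed

text \<open>A direct sum is generated by its summands, so an additive property need only be checked on
  families with one nonzero entry.\<close>

lemma direct_sum_induct [consumes 1, case_names groups zero incl add]: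
  assumes u: "u \<in> carrier (direct_sum I M)"
    and G: "\<And>i. i \<in> I \<Longrightarrow> abelian_group (M i)"
    and zero: "P \<zero>\<^bsub>direct_sum I M\<^esub>"
    and incl: "\<And>i m. \<lbrakk>i \<in> I; m \<in> carrier (M i)\<rbrakk> \<Longrightarrow> P (ds_incl I M i m)"
    and add: "\<And>u v. \<lbrakk>u \<in> carrier (direct_sum I M); v \<in> carrier (direct_sum I M); P u; P v\<rbrakk>
      \<Longrightarrow> P (u \<oplus>\<^bsub>direct_sum I M\<^esub> v)"
  shows "P u"
proof -
  have "P u" if "finite F" "u \<in> carrier (direct_sum I M)" "{i \<in> I. u i \<noteq> \<zero>\<^bsub>M i\<^esub>} \<subseteq> F" for F u
    using that
  proof (induction F arbitrary: u)
    case empty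
    then have "u = \<zero>\<^bsub>direct_sum I M\<^esub>"
      by (auto simp: direct_sum_carrier direct_sum_simps extensional_def fun_eq_iff)
    then show ?case using zero by simp
  next
    case (insert i F)
    show ?case
    proof (cases "i \<in> I")
      case False
      then show ?thesis using insert by (intro insert.IH) auto
    next
      case True
      define v where "v = (\<lambda>j\<in>I. if j = i then \<zero>\<^bsub>M j\<^esub> else u j)"
      have uj: "u j \<in> carrier (M j)" if "j \<in> I" for j
        using insert.prems that by (auto simp: direct_sum_carrier)
      have supp: "{j \<in> I. v j \<noteq> \<zero>\<^bsub>M j\<^esub>} \<subseteq> F"
        using insert.prems by (auto simp: v_def)
      have v: "v \<in> carrier (direct_sum I M)"
        using uj finite_subset[OF supp] insert.hyps abelian_groupE(2)[OF G]
        by (auto simp: direct_sum_carrier v_def)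
      have eq: "u j = (if j = i then u i else \<zero>\<^bsub>M j\<^esub>) \<oplus>\<^bsub>M j\<^esub> (if j = i then \<zero>\<^bsub>M j\<^esub> else u j)"
        if "j \<in> I" for j
      proof -
        interpret abelian_group "M j" using G that .
        show ?thesis using l_zero[OF uj[OF that]] r_zero[OF uj[OF that]] by auto
      qed
      have "u = ds_incl I M i (u i) \<oplus>\<^bsub>direct_sum I M\<^esub> v"
      proof
        fix j show "u j = (ds_incl I M i (u i) \<oplus>\<^bsub>direct_sum I M\<^esub> v) j"
          using eq[of j] insert.prems(1)
          by (auto simp: ds_incl_def v_def direct_sum_simps direct_sum_carrier extensional_def)
      qed
      then show ?thesis
        using add[of "ds_incl I M i (u i)" v] ds_incl_closed[of I M, OF G] v
          incl[OF True uj[OF True]] uj[OF True] insert.IH[OF v supp] by simp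
    qed
  qed
  then show ?thesis using u by (auto simp: direct_sum_carrier)
qed


section \<open>Multipliers given by one entry of a matrix\<close>

context r_semicategory
begin

lemma hom_group: "\<lbrakk>y \<in> Obj C; x \<in> Obj C\<rbrakk> \<Longrightarrow> abelian_group (Hom C y x)"
  using hom_module module.axioms(2) by blast

lemma comp_left_additive:
  "\<lbrakk>z \<in> Obj C; y \<in> Obj C; x \<in> Obj C; f \<in> carrier (Hom C z y)\<rbrakk>
    \<Longrightarrow> Comp C z y x f \<in> additive_maps (Hom C y x) (Hom C z x)"
  using comp_closed comp_add_right by (simp add: additive_maps_def hom_def Pi_def)

lemma comp_right_additive:
  "\<lbrakk>z \<in> Obj C; y \<in> Obj C; x \<in> Obj C; l \<in> carrier (Hom C y x)\<rbrakk>
    \<Longrightarrow> (\<lambda>f. Comp C z y x f l) \<in> additive_maps (Hom C z y) (Hom C z x)"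
  using comp_closed comp_add_left by (simp add: additive_maps_def hom_def Pi_def)

lemma comp_zero_right:
  "\<lbrakk>z \<in> Obj C; y \<in> Obj C; x \<in> Obj C; f \<in> carrier (Hom C z y)\<rbrakk>
    \<Longrightarrow> Comp C z y x f \<zero>\<^bsub>Hom C y x\<^esub> = \<zero>\<^bsub>Hom C z x\<^esub>"
  by (rule additive_zero[OF _ _ comp_left_additive]) (auto intro: hom_group)

lemma comp_zero_left:
  "\<lbrakk>z \<in> Obj C; y \<in> Obj C; x \<in> Obj C; l \<in> carrier (Hom C y x)\<rbrakk>
    \<Longrightarrow> Comp C z y x \<zero>\<^bsub>Hom C z y\<^esub> l = \<zero>\<^bsub>Hom C z x\<^esub>"
  by (rule additive_zero[OF _ _ comp_right_additive]) (auto intro: hom_group)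

lemma comp_assoc_hom:
  "\<lbrakk>w \<in> Obj C; z \<in> Obj C; y \<in> Obj C; x \<in> Obj C; f \<in> carrier (Hom C w z);
    l \<in> carrier (Hom C z y); h \<in> carrier (Hom C y x)\<rbrakk>
    \<Longrightarrow> Comp C w y x (Comp C w z y f l) h = Comp C w z x f (Comp C z y x l h)"
  using comp_associative unfolding semicat_associative_def by blast

lemma algebra_carrier:
  "M \<in> carrier (semicat_algebra C) \<longleftrightarrow> M \<in> extensional (Obj C \<times> Obj C) \<and>
     (\<forall>y\<in>Obj C. \<forall>x\<in>Obj C. M (y, x) \<in> carrier (Hom C y x)) \<and>
     finite {(y, x). y \<in> Obj C \<and> x \<in> Obj C \<and> M (y, x) \<noteq> \<zero>\<^bsub>Hom C y x\<^esub>}"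
proof -
  have "{i \<in> Obj C \<times> Obj C. M i \<noteq> \<zero>\<^bsub>(case i of (y, x) \<Rightarrow> Hom C y x)\<^esub>}
      = {(y, x). y \<in> Obj C \<and> x \<in> Obj C \<and> M (y, x) \<noteq> \<zero>\<^bsub>Hom C y x\<^esub>}"
    by auto
  then show ?thesis
    unfolding semicat_algebra_def by (simp add: direct_sum_carrier split_beta)
qed

lemma algebra_add:
  "M \<oplus>\<^bsub>semicat_algebra C\<^esub> N
    = (\<lambda>(y, x)\<in>Obj C \<times> Obj C. M (y, x) \<oplus>\<^bsub>Hom C y x\<^esub> N (y, x))"
  unfolding semicat_algebra_def by (auto simp: direct_sum_simps)

text \<open>The index set in the matrix product depends on the factors.  Additive operations on the factors
  change it, so sums are compared over a larger finite set \<open>B\<close> that serves both sides.\<close>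

lemma algebra_mult_entry:
  assumes M: "M \<in> carrier (semicat_algebra C)" and N: "N \<in> carrier (semicat_algebra C)"
    and "z \<in> Obj C" "x \<in> Obj C" "finite B" "B \<subseteq> Obj C"
    and sup: "{y \<in> Obj C. M (z, y) \<noteq> \<zero>\<^bsub>Hom C z y\<^esub> \<and> N (y, x) \<noteq> \<zero>\<^bsub>Hom C y x\<^esub>} \<subseteq> B"
  shows "(M \<otimes>\<^bsub>semicat_algebra C\<^esub> N) (z, x)
    = (\<Oplus>\<^bsub>Hom C z x\<^esub> y \<in> B. Comp C z y x (M (z, y)) (N (y, x)))"
proof -
  interpret abelian_group "Hom C z x" using assms hom_group by simp
  have e: "M (z, y) \<in> carrier (Hom C z y)" "N (y, x) \<in> carrier (Hom C y x)" if "y \<in> Obj C" for y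
    using M N that assms(3,4) by (auto simp: algebra_carrier)
  have "(M \<otimes>\<^bsub>semicat_algebra C\<^esub> N) (z, x) = finsum (Hom C z x)
    (\<lambda>y. Comp C z y x (M (z, y)) (N (y, x)))
    {y \<in> Obj C. M (z, y) \<noteq> \<zero>\<^bsub>Hom C z y\<^esub> \<and> N (y, x) \<noteq> \<zero>\<^bsub>Hom C y x\<^esub>}"
    using assms(3,4) by (simp add: semicat_algebra_def)
  also have "\<dots> = (\<Oplus>\<^bsub>Hom C z x\<^esub> y \<in> B. Comp C z y x (M (z, y)) (N (y, x)))"
  proof (rule finsum_superset[OF assms(5) sup])
    show "(\<lambda>y. Comp C z y x (M (z, y)) (N (y, x))) \<in> B \<rightarrow> carrier (Hom C z x)"
      using e assms(3,4,6) comp_closed by blast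
  next
    fix y assume y: "y \<in> B - {y \<in> Obj C. M (z, y) \<noteq> \<zero>\<^bsub>Hom C z y\<^esub> \<and> N (y, x) \<noteq> \<zero>\<^bsub>Hom C y x\<^esub>}"
    then have "y \<in> Obj C" using assms(6) by blast
    with y show "Comp C z y x (M (z, y)) (N (y, x)) = \<zero>\<^bsub>Hom C z x\<^esub>"
      using e[of y] assms(3,4) comp_zero_left comp_zero_right by fastforce
  qed
  finally show ?thesis .
qed

lemma algebra_row_finite:
  assumes "M \<in> carrier (semicat_algebra C)" "z \<in> Obj C"
  shows "finite {y \<in> Obj C. M (z, y) \<noteq> \<zero>\<^bsub>Hom C z y\<^esub>}"
proof (rule finite_surj)
  show "finite {(y, x). y \<in> Obj C \<and> x \<in> Obj C \<and> M (y, x) \<noteq> \<zero>\<^bsub>Hom C y x\<^esub>}"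
    using assms by (simp add: algebra_carrier)
  show "{y \<in> Obj C. M (z, y) \<noteq> \<zero>\<^bsub>Hom C z y\<^esub>}
      \<subseteq> snd ` {(y, x). y \<in> Obj C \<and> x \<in> Obj C \<and> M (y, x) \<noteq> \<zero>\<^bsub>Hom C y x\<^esub>}"
    using assms(2) by force
qed

lemma algebra_column_finite:
  assumes "M \<in> carrier (semicat_algebra C)" "x \<in> Obj C"
  shows "finite {y \<in> Obj C. M (y, x) \<noteq> \<zero>\<^bsub>Hom C y x\<^esub>}"
proof (rule finite_surj)
  show "finite {(y, x). y \<in> Obj C \<and> x \<in> Obj C \<and> M (y, x) \<noteq> \<zero>\<^bsub>Hom C y x\<^esub>}"
    using assms by (simp add: algebra_carrier)
  show "{y \<in> Obj C. M (y, x) \<noteq> \<zero>\<^bsub>Hom C y x\<^esub>}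
      \<subseteq> fst ` {(y, x). y \<in> Obj C \<and> x \<in> Obj C \<and> M (y, x) \<noteq> \<zero>\<^bsub>Hom C y x\<^esub>}"
    using assms(2) by force
qed

end

text \<open>The operators \<open>lam v\<close> and \<open>rho u\<close> behave like multiplication by one morphism from \<open>q\<close> to
  \<open>p\<close>, which need not belong to \<open>C\<close>: composing with it on the left carries \<open>Hom C q v\<close> to
  \<open>Hom C p v\<close>, and composing with it on the right carries \<open>Hom C u p\<close> to \<open>Hom C u q\<close>.\<close>

locale entry_multiplier = r_semicategory R C
  for R :: "'r ring" and C :: "('r, 'm, 'o) semicat_data" +
  fixes p q :: 'o and lam rho :: "'o \<Rightarrow> 'm \<Rightarrow> 'm"
  assumes p_obj: "p \<in> Obj C" and q_obj: "q \<in> Obj C"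
    and lam_additive: "v \<in> Obj C \<Longrightarrow> lam v \<in> additive_maps (Hom C q v) (Hom C p v)"
    and rho_additive: "u \<in> Obj C \<Longrightarrow> rho u \<in> additive_maps (Hom C u p) (Hom C u q)"
    and lam_comp:
      "\<lbrakk>v \<in> Obj C; w \<in> Obj C; f \<in> carrier (Hom C q v); l \<in> carrier (Hom C v w)\<rbrakk>
       \<Longrightarrow> lam w (Comp C q v w f l) = Comp C p v w (lam v f) l"
    and rho_comp:
      "\<lbrakk>u \<in> Obj C; v \<in> Obj C; f \<in> carrier (Hom C u v); l \<in> carrier (Hom C v p)\<rbrakk>
       \<Longrightarrow> rho u (Comp C u v p f l) = Comp C u v q f (rho v l)"
    and rho_lam:
      "\<lbrakk>u \<in> Obj C; v \<in> Obj C; f \<in> carrier (Hom C u p); l \<in> carrier (Hom C q v)\<rbrakk>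
       \<Longrightarrow> Comp C u q v (rho u f) l = Comp C u p v f (lam v l)"
begin

definition left_mult :: "('o \<times> 'o \<Rightarrow> 'm) \<Rightarrow> 'o \<times> 'o \<Rightarrow> 'm" where
  "left_mult M = (\<lambda>(u, v)\<in>Obj C \<times> Obj C. if u = p then lam v (M (q, v)) else \<zero>\<^bsub>Hom C u v\<^esub>)"

definition right_mult :: "('o \<times> 'o \<Rightarrow> 'm) \<Rightarrow> 'o \<times> 'o \<Rightarrow> 'm" where
  "right_mult M = (\<lambda>(u, v)\<in>Obj C \<times> Obj C. if v = q then rho u (M (u, p)) else \<zero>\<^bsub>Hom C u v\<^esub>)"

lemma lam_closed: "\<lbrakk>v \<in> Obj C; f \<in> carrier (Hom C q v)\<rbrakk> \<Longrightarrow> lam v f \<in> carrier (Hom C p v)"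
  using lam_additive by (auto simp: additive_maps_def hom_def)

lemma rho_closed: "\<lbrakk>u \<in> Obj C; f \<in> carrier (Hom C u p)\<rbrakk> \<Longrightarrow> rho u f \<in> carrier (Hom C u q)"
  using rho_additive by (auto simp: additive_maps_def hom_def)

lemma lam_zero: "v \<in> Obj C \<Longrightarrow> lam v \<zero>\<^bsub>Hom C q v\<^esub> = \<zero>\<^bsub>Hom C p v\<^esub>"
  by (rule additive_zero[OF _ _ lam_additive]) (auto intro: hom_group p_obj q_obj)

lemma rho_zero: "u \<in> Obj C \<Longrightarrow> rho u \<zero>\<^bsub>Hom C u p\<^esub> = \<zero>\<^bsub>Hom C u q\<^esub>"
  by (rule additive_zero[OF _ _ rho_additive]) (auto intro: hom_group p_obj q_obj)

lemma entry: "\<lbrakk>M \<in> carrier (semicat_algebra C); u \<in> Obj C; v \<in> Obj C\<rbrakk>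
    \<Longrightarrow> M (u, v) \<in> carrier (Hom C u v)"
  by (simp add: algebra_carrier)

lemma zero_entry: "\<lbrakk>u \<in> Obj C; v \<in> Obj C\<rbrakk> \<Longrightarrow> \<zero>\<^bsub>Hom C u v\<^esub> \<in> carrier (Hom C u v)"
  using abelian_groupE(2)[OF hom_group] .

lemma zero_entry_add: "\<lbrakk>u \<in> Obj C; v \<in> Obj C\<rbrakk>
    \<Longrightarrow> \<zero>\<^bsub>Hom C u v\<^esub> \<oplus>\<^bsub>Hom C u v\<^esub> \<zero>\<^bsub>Hom C u v\<^esub> = \<zero>\<^bsub>Hom C u v\<^esub>"
  using abelian_groupE(5)[OF hom_group] zero_entry by blast

lemma left_mult_closed:
  assumes "M \<in> carrier (semicat_algebra C)"
  shows "left_mult M \<in> carrier (semicat_algebra C)"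
proof -
  have "finite {(u, v). u \<in> Obj C \<and> v \<in> Obj C \<and> left_mult M (u, v) \<noteq> \<zero>\<^bsub>Hom C u v\<^esub>}"
  proof (rule finite_subset)
    show "{(u, v). u \<in> Obj C \<and> v \<in> Obj C \<and> left_mult M (u, v) \<noteq> \<zero>\<^bsub>Hom C u v\<^esub>}
        \<subseteq> {p} \<times> {v \<in> Obj C. M (q, v) \<noteq> \<zero>\<^bsub>Hom C q v\<^esub>}"
      using lam_zero by (auto simp: left_mult_def split: if_splits)
  qed (use algebra_row_finite[OF assms q_obj] in simp)
  then show ?thesis
    using entry[OF assms q_obj] lam_closed zero_entry
    by (auto simp: algebra_carrier left_mult_def)
qed

lemma right_mult_closed:
  assumes "M \<in> carrier (semicat_algebra C)"
  shows "right_mult M \<in> carrier (semicat_algebra C)"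
proof -
  have "finite {(u, v). u \<in> Obj C \<and> v \<in> Obj C \<and> right_mult M (u, v) \<noteq> \<zero>\<^bsub>Hom C u v\<^esub>}"
  proof (rule finite_subset)
    show "{(u, v). u \<in> Obj C \<and> v \<in> Obj C \<and> right_mult M (u, v) \<noteq> \<zero>\<^bsub>Hom C u v\<^esub>}
        \<subseteq> {u \<in> Obj C. M (u, p) \<noteq> \<zero>\<^bsub>Hom C u p\<^esub>} \<times> {q}"
      using rho_zero by (auto simp: right_mult_def split: if_splits)
  qed (use algebra_column_finite[OF assms p_obj] in simp)
  then show ?thesis
    using entry[OF assms _ p_obj] rho_closed zero_entry
    by (auto simp: algebra_carrier right_mult_def)
qed

lemma left_mult_mult:
  assumes M: "M \<in> carrier (semicat_algebra C)" and N: "N \<in> carrier (semicat_algebra C)"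
  shows "left_mult (M \<otimes>\<^bsub>semicat_algebra C\<^esub> N) = left_mult M \<otimes>\<^bsub>semicat_algebra C\<^esub> N"
proof (rule ext, clarify)
  fix u x
  show "left_mult (M \<otimes>\<^bsub>semicat_algebra C\<^esub> N) (u, x)
      = (left_mult M \<otimes>\<^bsub>semicat_algebra C\<^esub> N) (u, x)"
  proof (cases "u \<in> Obj C \<and> x \<in> Obj C")
    case False
    then show ?thesis by (auto simp: left_mult_def semicat_algebra_def)
  next
    case True
    let ?B = "{y \<in> Obj C. M (q, y) \<noteq> \<zero>\<^bsub>Hom C q y\<^esub>}"
    note fin = algebra_row_finite[OF M q_obj]
    interpret ux: abelian_group "Hom C u x" using True hom_group by blast
    show ?thesis
    proof (cases "u = p")
      case u: True
      have x: "x \<in> Obj C" using True by simp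
      have c: "(\<lambda>y. Comp C q y x (M (q, y)) (N (y, x))) \<in> ?B \<rightarrow> carrier (Hom C q x)"
        using comp_closed entry[OF M q_obj] entry[OF N _ x] x q_obj by auto
      have "left_mult (M \<otimes>\<^bsub>semicat_algebra C\<^esub> N) (u, x)
          = lam x (\<Oplus>\<^bsub>Hom C q x\<^esub> y \<in> ?B. Comp C q y x (M (q, y)) (N (y, x)))"
        using u p_obj x algebra_mult_entry[OF M N q_obj x fin Collect_restrict Collect_mono]
        by (simp add: left_mult_def)
      also have "\<dots> = (\<Oplus>\<^bsub>Hom C p x\<^esub> y \<in> ?B. lam x (Comp C q y x (M (q, y)) (N (y, x))))"
        by (rule additive_finsum[OF _ _ lam_additive fin c])
          (use x p_obj q_obj hom_group in auto)
      also have "\<dots> = (\<Oplus>\<^bsub>Hom C u x\<^esub> y \<in> ?B. Comp C u y x (left_mult M (u, y)) (N (y, x)))"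
        unfolding u
      proof (rule ux.finsum_cong'[unfolded u])
        show "(\<lambda>y. Comp C p y x (left_mult M (p, y)) (N (y, x))) \<in> ?B \<rightarrow> carrier (Hom C p x)"
          using comp_closed entry[OF left_mult_closed[OF M] p_obj] entry[OF N _ x] x p_obj by auto
      next
        fix y assume "y \<in> ?B"
        then show "lam x (Comp C q y x (M (q, y)) (N (y, x)))
            = Comp C p y x (left_mult M (p, y)) (N (y, x))"
          using lam_comp[of y x] entry[OF M q_obj] entry[OF N _ x] x p_obj
          by (simp add: left_mult_def)
      qed simp
      also have "\<dots> = (left_mult M \<otimes>\<^bsub>semicat_algebra C\<^esub> N) (u, x)"
        by (rule algebra_mult_entry[OF left_mult_closed[OF M] N _ x fin, symmetric])
          (use u p_obj lam_zero in \<open>auto simp: left_mult_def\<close>)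
      finally show ?thesis .
    next
      case u: False
      have "(left_mult M \<otimes>\<^bsub>semicat_algebra C\<^esub> N) (u, x)
          = (\<Oplus>\<^bsub>Hom C u x\<^esub> y \<in> {}. Comp C u y x (left_mult M (u, y)) (N (y, x)))"
        by (rule algebra_mult_entry[OF left_mult_closed[OF M] N])
          (use u True in \<open>auto simp: left_mult_def\<close>)
      then show ?thesis using u True by (simp add: left_mult_def)
    qed
  qed
qed

lemma right_mult_mult:
  assumes M: "M \<in> carrier (semicat_algebra C)" and N: "N \<in> carrier (semicat_algebra C)"
  shows "right_mult (M \<otimes>\<^bsub>semicat_algebra C\<^esub> N) = M \<otimes>\<^bsub>semicat_algebra C\<^esub> right_mult N"
proof (rule ext, clarify)
  fix u x
  show "right_mult (M \<otimes>\<^bsub>semicat_algebra C\<^esub> N) (u, x)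
      = (M \<otimes>\<^bsub>semicat_algebra C\<^esub> right_mult N) (u, x)"
  proof (cases "u \<in> Obj C \<and> x \<in> Obj C")
    case False
    then show ?thesis by (auto simp: right_mult_def semicat_algebra_def)
  next
    case True
    let ?B = "{y \<in> Obj C. N (y, p) \<noteq> \<zero>\<^bsub>Hom C y p\<^esub>}"
    note fin = algebra_column_finite[OF N p_obj]
    interpret ux: abelian_group "Hom C u x" using True hom_group by blast
    show ?thesis
    proof (cases "x = q")
      case x: True
      have u: "u \<in> Obj C" using True by simp
      have c: "(\<lambda>y. Comp C u y p (M (u, y)) (N (y, p))) \<in> ?B \<rightarrow> carrier (Hom C u p)"
        using comp_closed entry[OF M u] entry[OF N _ p_obj] u p_obj by auto
      have "right_mult (M \<otimes>\<^bsub>semicat_algebra C\<^esub> N) (u, x)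
          = rho u (\<Oplus>\<^bsub>Hom C u p\<^esub> y \<in> ?B. Comp C u y p (M (u, y)) (N (y, p)))"
        using u x q_obj algebra_mult_entry[OF M N u p_obj fin Collect_restrict Collect_mono]
        by (simp add: right_mult_def)
      also have "\<dots> = (\<Oplus>\<^bsub>Hom C u q\<^esub> y \<in> ?B. rho u (Comp C u y p (M (u, y)) (N (y, p))))"
        by (rule additive_finsum[OF _ _ rho_additive fin c])
          (use u p_obj q_obj hom_group in auto)
      also have "\<dots> = (\<Oplus>\<^bsub>Hom C u x\<^esub> y \<in> ?B. Comp C u y x (M (u, y)) (right_mult N (y, x)))"
        unfolding x
      proof (rule ux.finsum_cong'[unfolded x])
        show "(\<lambda>y. Comp C u y q (M (u, y)) (right_mult N (y, q))) \<in> ?B \<rightarrow> carrier (Hom C u q)"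
          using comp_closed entry[OF right_mult_closed[OF N] _ q_obj] entry[OF M u] u q_obj by auto
      next
        fix y assume "y \<in> ?B"
        then show "rho u (Comp C u y p (M (u, y)) (N (y, p)))
            = Comp C u y q (M (u, y)) (right_mult N (y, q))"
          using rho_comp[of u y] entry[OF M u] entry[OF N _ p_obj] u q_obj
          by (simp add: right_mult_def)
      qed simp
      also have "\<dots> = (M \<otimes>\<^bsub>semicat_algebra C\<^esub> right_mult N) (u, x)"
        by (rule algebra_mult_entry[OF M right_mult_closed[OF N] u _ fin, symmetric])
          (use x q_obj rho_zero in \<open>auto simp: right_mult_def\<close>)
      finally show ?thesis .
    next
      case x: False
      have "(M \<otimes>\<^bsub>semicat_algebra C\<^esub> right_mult N) (u, x)
          = (\<Oplus>\<^bsub>Hom C u x\<^esub> y \<in> {}. Comp C u y x (M (u, y)) (right_mult N (y, x)))"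
        by (rule algebra_mult_entry[OF M right_mult_closed[OF N]])
          (use x True in \<open>auto simp: right_mult_def\<close>)
      then show ?thesis using x True by (simp add: right_mult_def)
    qed
  qed
qed

text \<open>Each entry of either product has a single summand: the first matrix has only the column
  \<open>q\<close>, respectively the second has only the row \<open>p\<close>.\<close>

lemma right_mult_left_mult:
  assumes M: "M \<in> carrier (semicat_algebra C)" and N: "N \<in> carrier (semicat_algebra C)"
  shows "right_mult M \<otimes>\<^bsub>semicat_algebra C\<^esub> N = M \<otimes>\<^bsub>semicat_algebra C\<^esub> left_mult N"
proof (rule ext, clarify)
  fix u x
  show "(right_mult M \<otimes>\<^bsub>semicat_algebra C\<^esub> N) (u, x)
      = (M \<otimes>\<^bsub>semicat_algebra C\<^esub> left_mult N) (u, x)"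
  proof (cases "u \<in> Obj C \<and> x \<in> Obj C")
    case False
    then show ?thesis by (auto simp: semicat_algebra_def)
  next
    case True
    then have u: "u \<in> Obj C" and x: "x \<in> Obj C" by auto
    interpret ux: abelian_group "Hom C u x" using True hom_group by blast
    have e: "M (u, p) \<in> carrier (Hom C u p)" "N (q, x) \<in> carrier (Hom C q x)"
      using entry M N u x p_obj q_obj by auto
    have "(right_mult M \<otimes>\<^bsub>semicat_algebra C\<^esub> N) (u, x)
        = (\<Oplus>\<^bsub>Hom C u x\<^esub> y \<in> {q}. Comp C u y x (right_mult M (u, y)) (N (y, x)))"
      by (rule algebra_mult_entry[OF right_mult_closed[OF M] N u x])
        (use u x q_obj in \<open>auto simp: right_mult_def split: if_splits\<close>)
    also have "\<dots> = Comp C u q x (rho u (M (u, p))) (N (q, x))"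
      using comp_closed rho_closed e u x q_obj by (simp add: right_mult_def)
    also have "\<dots> = Comp C u p x (M (u, p)) (lam x (N (q, x)))"
      by (rule rho_lam[OF u x e])
    also have "\<dots> = (\<Oplus>\<^bsub>Hom C u x\<^esub> y \<in> {p}. Comp C u y x (M (u, y)) (left_mult N (y, x)))"
      using comp_closed lam_closed e u x p_obj by (simp add: left_mult_def)
    also have "\<dots> = (M \<otimes>\<^bsub>semicat_algebra C\<^esub> left_mult N) (u, x)"
      by (rule algebra_mult_entry[OF M left_mult_closed[OF N] u x, symmetric])
        (use u x p_obj in \<open>auto simp: left_mult_def split: if_splits\<close>)
    finally show ?thesis .
  qed
qed

lemma multiplier_left_right: "multiplier (semicat_algebra C) left_mult right_mult"
proof -
  have "left_mult (M \<oplus>\<^bsub>semicat_algebra C\<^esub> N)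
      = left_mult M \<oplus>\<^bsub>semicat_algebra C\<^esub> left_mult N"
    if "M \<in> carrier (semicat_algebra C)" "N \<in> carrier (semicat_algebra C)" for M N
    using lam_additive entry[OF that(1) q_obj] entry[OF that(2) q_obj] zero_entry_add p_obj q_obj
    by (auto simp: algebra_add left_mult_def additive_maps_def hom_def)
  moreover have "right_mult (M \<oplus>\<^bsub>semicat_algebra C\<^esub> N)
      = right_mult M \<oplus>\<^bsub>semicat_algebra C\<^esub> right_mult N"
    if "M \<in> carrier (semicat_algebra C)" "N \<in> carrier (semicat_algebra C)" for M N
    using rho_additive entry[OF that(1) _ p_obj] entry[OF that(2) _ p_obj] zero_entry_add p_obj q_obj
    by (auto simp: algebra_add right_mult_def additive_maps_def hom_def)
  ultimately show ?thesis
    using left_mult_closed right_mult_closed left_mult_mult right_mult_mult right_mult_left_mult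
    by (simp add: multiplier_def additive_maps_def hom_def)
qed

end

text \<open>Evaluate the commutation of the two matrix multipliers at the matrix whose only nonzero
  entry is \<open>l\<close>.\<close>

lemma LR_associative_entry_multipliers:
  assumes "LR_associative C"
    and 1: "entry_multiplier R C p q lam rho" and 2: "entry_multiplier R C p' q' lam' rho'"
    and l: "l \<in> carrier (Hom C q p')"
  shows "rho' p (lam p' l) = lam q' (rho' q l)"
proof -
  interpret m: entry_multiplier R C p q lam rho by fact
  interpret m': entry_multiplier R C p' q' lam' rho' by fact
  define M where "M = ds_incl (Obj C \<times> Obj C) (\<lambda>(y, x). Hom C y x) (q, p') l"
  have "M \<in> carrier (direct_sum (Obj C \<times> Obj C) (\<lambda>(y, x). Hom C y x))"
    unfolding M_def by (rule ds_incl_closed) (use l m.hom_group in auto)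
  then have "M \<in> carrier (semicat_algebra C)"
    by (simp add: semicat_algebra_def)
  then have "m'.right_mult (m.left_mult M) = m.left_mult (m'.right_mult M)"
    using assms(1) m.multiplier_left_right m'.multiplier_left_right
    unfolding LR_associative_def LR_associative_ring_def by blast
  then have "m'.right_mult (m.left_mult M) (p, q') = m.left_mult (m'.right_mult M) (p, q')"
    by simp
  then show ?thesis
    using m.p_obj m.q_obj m'.p_obj m'.q_obj
    by (simp add: m.left_mult_def m'.right_mult_def M_def ds_incl_def)
qed


section \<open>Partial actions on semicategories\<close>

lemma ideal_semicat_simps [simp]:
  "Obj (ideal_semicat C A g) = Obj C"
  "carrier (Hom (ideal_semicat C A g) y x) = Idl A g y x"
  "zero (Hom (ideal_semicat C A g) y x) = zero (Hom C y x)"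
  "add (Hom (ideal_semicat C A g) y x) = add (Hom C y x)"
  "smult (Hom (ideal_semicat C A g) y x) = smult (Hom C y x)"
  "Comp (ideal_semicat C A g) = Comp C"
  by (simp_all add: ideal_semicat_def sub_semicat_def)

context partial_action_semicat
begin

lemma Idl_tgt_submodule:
  "\<lbrakk>g \<in> mor G; y \<in> Obj C; x \<in> Obj C\<rbrakk> \<Longrightarrow> submodule (Idl A (tgt G g) y x) R (Hom C y x)"
  using Idl_tgt_ideal by (simp add: semicat_ideal_def)

lemma Idl_submodule:
  "\<lbrakk>g \<in> mor G; y \<in> Obj C; x \<in> Obj C\<rbrakk>
    \<Longrightarrow> submodule (Idl A g y x) R (Hom (ideal_semicat C A (tgt G g)) y x)"
  using Idl_ideal by (simp add: semicat_ideal_def)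

lemma Idl_tgt_module:
  "\<lbrakk>g \<in> mor G; y \<in> Obj C; x \<in> Obj C\<rbrakk> \<Longrightarrow> module R (Hom (ideal_semicat C A (tgt G g)) y x)"
  using submodule.submodule_is_module[OF Idl_tgt_submodule hom_module]
  by (simp add: ideal_semicat_def sub_semicat_def)

lemma Idl_module:
  "\<lbrakk>g \<in> mor G; y \<in> Obj C; x \<in> Obj C\<rbrakk> \<Longrightarrow> module R (Hom (ideal_semicat C A g) y x)"
  using submodule.submodule_is_module[OF Idl_submodule Idl_tgt_module]
  by (simp add: ideal_semicat_def sub_semicat_def)

lemma Idl_subset_tgt:
  "\<lbrakk>g \<in> mor G; y \<in> Obj C; x \<in> Obj C; f \<in> Idl A g y x\<rbrakk> \<Longrightarrow> f \<in> Idl A (tgt G g) y x"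
  using module.submoduleE(1)[OF Idl_tgt_module Idl_submodule] by auto

lemma Idl_subset_hom:
  "\<lbrakk>g \<in> mor G; y \<in> Obj C; x \<in> Obj C; f \<in> Idl A g y x\<rbrakk> \<Longrightarrow> f \<in> carrier (Hom C y x)"
  using module.submoduleE(1)[OF hom_module Idl_tgt_submodule] Idl_subset_tgt by blast

lemma Idl_comp_left:
  "\<lbrakk>g \<in> mor G; z \<in> Obj C; y \<in> Obj C; x \<in> Obj C; f \<in> Idl A (tgt G g) z y; l \<in> Idl A g y x\<rbrakk>
    \<Longrightarrow> Comp C z y x f l \<in> Idl A g z x"
  using Idl_ideal by (simp add: semicat_ideal_def)

lemma Idl_comp_right:
  "\<lbrakk>g \<in> mor G; z \<in> Obj C; y \<in> Obj C; x \<in> Obj C; f \<in> Idl A g z y; l \<in> Idl A (tgt G g) y x\<rbrakk>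
    \<Longrightarrow> Comp C z y x f l \<in> Idl A g z x"
  using Idl_ideal by (simp add: semicat_ideal_def)

lemma ideal_r_semicategory:
  assumes "g \<in> mor G"
  shows "r_semicategory R (ideal_semicat C A g)"
proof -
  note hom = Idl_subset_hom[OF assms]
  have "semicat_associative (ideal_semicat C A g)"
    unfolding semicat_associative_def using comp_assoc_hom hom by simp
  then show ?thesis
    using Idl_module[OF assms] Idl_comp_left[OF assms] Idl_subset_tgt[OF assms] hom
    by (intro r_semicategory.intro)
      (simp_all add: comp_add_left comp_add_right comp_smult_left comp_smult_right)
qed

lemma Idl_group:
  "\<lbrakk>g \<in> mor G; y \<in> Obj C; x \<in> Obj C\<rbrakk> \<Longrightarrow> abelian_group (Hom (ideal_semicat C A g) y x)"
  using r_semicategory.hom_group[OF ideal_r_semicategory] by simp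

lemma Idl_zero_closed:
  "\<lbrakk>g \<in> mor G; y \<in> Obj C; x \<in> Obj C\<rbrakk> \<Longrightarrow> \<zero>\<^bsub>Hom C y x\<^esub> \<in> Idl A g y x"
  using abelian_groupE(2)[OF Idl_group] by simp

lemma Idl_vanish:
  "\<lbrakk>g \<in> mor G; y \<in> Obj C; x \<in> Obj C; f \<in> Idl A g y x; y \<notin> ob_dom A g \<or> x \<notin> ob_dom A g\<rbrakk>
    \<Longrightarrow> f = \<zero>\<^bsub>Hom C y x\<^esub>"
  using Idl_zero by blast

lemma ob_in_Obj: "\<lbrakk>g \<in> mor G; x \<in> ob_dom A g\<rbrakk> \<Longrightarrow> x \<in> Obj C"
  using dom_subset by blast

lemma act_semifunctor:
  "g \<in> mor G \<Longrightarrow> r_semifunctor R (sub_semicat C (ob_dom A (ginv G g)) (Idl A (ginv G g)))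
     (sub_semicat C (ob_dom A g) (Idl A g)) (ob_act A g) (act A g)"
  using act_equivalence by (simp add: r_equivalence_def)

lemma act_closed:
  "\<lbrakk>g \<in> mor G; y \<in> ob_dom A (ginv G g); x \<in> ob_dom A (ginv G g); f \<in> Idl A (ginv G g) y x\<rbrakk>
    \<Longrightarrow> act A g y x f \<in> Idl A g (ob_act A g y) (ob_act A g x)"
  using act_semifunctor by (simp add: r_semifunctor_def sub_semicat_def)

lemma act_add:
  "\<lbrakk>g \<in> mor G; y \<in> ob_dom A (ginv G g); x \<in> ob_dom A (ginv G g);
    f \<in> Idl A (ginv G g) y x; f' \<in> Idl A (ginv G g) y x\<rbrakk>
    \<Longrightarrow> act A g y x (f \<oplus>\<^bsub>Hom C y x\<^esub> f')
      = act A g y x f \<oplus>\<^bsub>Hom C (ob_act A g y) (ob_act A g x)\<^esub> act A g y x f'"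
  using act_semifunctor by (simp add: r_semifunctor_def sub_semicat_def)

lemma act_mult:
  "\<lbrakk>g \<in> mor G; z \<in> ob_dom A (ginv G g); y \<in> ob_dom A (ginv G g); x \<in> ob_dom A (ginv G g);
    f \<in> Idl A (ginv G g) z y; l \<in> Idl A (ginv G g) y x\<rbrakk>
    \<Longrightarrow> act A g z x (Comp C z y x f l)
      = Comp C (ob_act A g z) (ob_act A g y) (ob_act A g x) (act A g z y f) (act A g y x l)"
  using act_semifunctor by (simp add: r_semifunctor_def sub_semicat_def)

lemma act_additive:
  "\<lbrakk>g \<in> mor G; y \<in> ob_dom A (ginv G g); x \<in> ob_dom A (ginv G g)\<rbrakk>
    \<Longrightarrow> act A g y x \<in> additive_maps (Hom (ideal_semicat C A (ginv G g)) y x)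
          (Hom (ideal_semicat C A g) (ob_act A g y) (ob_act A g x))"
  using act_closed act_add by (simp add: additive_maps_def hom_def Pi_def)

lemma act_zero:
  assumes "g \<in> mor G" "y \<in> ob_dom A (ginv G g)" "x \<in> ob_dom A (ginv G g)"
  shows "act A g y x \<zero>\<^bsub>Hom C y x\<^esub> = \<zero>\<^bsub>Hom C (ob_act A g y) (ob_act A g x)\<^esub>"
  using additive_zero[OF Idl_group Idl_group act_additive[OF assms]] assms
  by (simp add: ginv_simps ob_in_Obj[of g] ob_in_Obj[of "ginv G g"] point_in_dom)

lemma ginv_act_act:
  assumes g: "g \<in> mor G" and x: "x \<in> ob_dom A (ginv G g)" and y: "y \<in> ob_dom A (ginv G g)"
    and f: "f \<in> Idl A (ginv G g) y x"
  shows "act A (ginv G g) (ob_act A g y) (ob_act A g x) (act A g y x f) = f"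
proof -
  let ?x = "ob_act A g x" and ?y = "ob_act A g y" and ?e = "src G g"
  have i: "ginv G g \<in> mor G" using g by (simp add: ginv_simps)
  have c: "composable G (ginv G g) g" using g by (simp add: composable_def ginv_simps)
  have xy: "?x \<in> ob_dom A g" "?y \<in> ob_dom A g" using x y g point_in_dom by auto
  \<comment> \<open>The rule for composites applies to elements written as \<open>act A (ginv G g) \<dots>\<close>, so surjectivity
    of this map is needed first.\<close>
  have "bij_betw (act A (ginv G g) ?y ?x) (Idl A g ?y ?x) (Idl A (ginv G g) y x)"
    using act_equivalence[OF i] xy point_inv_cancel[OF g x] point_inv_cancel[OF g y] g
    by (fastforce simp: r_equivalence_def sub_semicat_def ginv_ginv)
  then have "f \<in> act A (ginv G g) ?y ?x ` (Idl A g ?y ?x \<inter> Idl A g ?y ?x)"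
    using f by (simp add: bij_betw_def)
  then have "act A (ginv G g) ?y ?x (act A g y x f) = act A ?e y x f"
    using act_comp[OF c, of ?x ?y y x f] xy g x y point_inv_cancel[OF g] by (simp add: ginv_simps ginv_ginv)
  moreover have "x \<in> ob_dom A ?e" "y \<in> ob_dom A ?e" "f \<in> Idl A ?e y x"
    using D_tgt[OF i] x y f Idl_subset_tgt[OF i] ob_in_Obj[OF i] g by (auto simp: ginv_simps)
  ultimately show ?thesis using act_id src_id[OF g] by simp
qed

lemma act_ginv_closed:
  "\<lbrakk>g \<in> mor G; y \<in> ob_dom A g; x \<in> ob_dom A g; f \<in> Idl A g y x\<rbrakk>
    \<Longrightarrow> act A (ginv G g) y x f \<in> Idl A (ginv G g) (ob_act A (ginv G g) y) (ob_act A (ginv G g) x)"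
  using act_closed[of "ginv G g"] by (simp add: ginv_simps ginv_ginv)

lemma act_ginv_mult:
  "\<lbrakk>g \<in> mor G; z \<in> ob_dom A g; y \<in> ob_dom A g; x \<in> ob_dom A g;
    f \<in> Idl A g z y; l \<in> Idl A g y x\<rbrakk>
    \<Longrightarrow> act A (ginv G g) z x (Comp C z y x f l)
      = Comp C (ob_act A (ginv G g) z) (ob_act A (ginv G g) y) (ob_act A (ginv G g) x)
          (act A (ginv G g) z y f) (act A (ginv G g) y x l)"
  using act_mult[of "ginv G g"] by (simp add: ginv_simps ginv_ginv)

lemma act_ginv_additive:
  "\<lbrakk>g \<in> mor G; y \<in> ob_dom A g; x \<in> ob_dom A g\<rbrakk>
    \<Longrightarrow> act A (ginv G g) y x \<in> additive_maps (Hom (ideal_semicat C A g) y x)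
       (Hom (ideal_semicat C A (ginv G g)) (ob_act A (ginv G g) y) (ob_act A (ginv G g) x))"
  using act_additive[of "ginv G g"] by (simp add: ginv_simps ginv_ginv)

lemma act_act_ginv:
  "\<lbrakk>g \<in> mor G; x \<in> ob_dom A g; y \<in> ob_dom A g; f \<in> Idl A g y x\<rbrakk>
    \<Longrightarrow> act A g (ob_act A (ginv G g) y) (ob_act A (ginv G g) x) (act A (ginv G g) y x f) = f"
  using ginv_act_act[of "ginv G g"] by (simp add: ginv_simps ginv_ginv)

text \<open>The first of the two multipliers of the ideal at \<open>t\<close>: composition with a morphism of the
  larger ideal at the target of \<open>t\<close>.  It preserves the ideal, and its laws are the associativity of
  \<open>C\<close>.\<close>

lemma composition_entry_multiplier:
  assumes t: "t \<in> mor G" and p: "p \<in> Obj C" and q: "q \<in> Obj C" and f: "f \<in> Idl A (tgt G t) p q"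
  shows "entry_multiplier R (ideal_semicat C A t) p q
    (\<lambda>v. Comp C p q v f) (\<lambda>u m. Comp C u p q m f)"
proof -
  interpret I: r_semicategory R "ideal_semicat C A t" by (rule ideal_r_semicategory[OF t])
  have fC: "f \<in> carrier (Hom C p q)"
    using module.submoduleE(1)[OF hom_module Idl_tgt_submodule] t p q f by blast
  note hom = Idl_subset_hom[OF t]
  show ?thesis
    by unfold_locales
      (use p q f fC hom Idl_comp_left[OF t] Idl_comp_right[OF t] in
        \<open>simp_all add: additive_maps_def hom_def Pi_def comp_add_left comp_add_right comp_assoc_hom\<close>)
qed

text \<open>The second one: composition with \<open>h\<close> on the ideal at the inverse of \<open>t\<close>, transported
  along the action of \<open>t\<close>.  The action has no meaning at an object outside the domain of \<open>t\<close>, but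
  there the ideal is zero, so zero is the only possible value.\<close>

definition conj_left :: "'g \<Rightarrow> 'o \<Rightarrow> 'o \<Rightarrow> 'm \<Rightarrow> 'o \<Rightarrow> 'm \<Rightarrow> 'm" where
  "conj_left t y q h v m =
    (if v \<in> ob_dom A t
     then act A t y (ob_act A (ginv G t) v)
       (Comp C y q (ob_act A (ginv G t) v) h (act A (ginv G t) (ob_act A t q) v m))
     else \<zero>\<^bsub>Hom C (ob_act A t y) v\<^esub>)"

definition conj_right :: "'g \<Rightarrow> 'o \<Rightarrow> 'o \<Rightarrow> 'm \<Rightarrow> 'o \<Rightarrow> 'm \<Rightarrow> 'm" where
  "conj_right t y q h u m =
    (if u \<in> ob_dom A t
     then act A t (ob_act A (ginv G t) u) q
       (Comp C (ob_act A (ginv G t) u) y q (act A (ginv G t) u (ob_act A t y) m) h)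
     else \<zero>\<^bsub>Hom C u (ob_act A t q)\<^esub>)"

text \<open>At objects in the domain of \<open>t\<close> the three laws are the associativity of \<open>C\<close> for the pulled-back
  morphisms, since the action of \<open>t\<close> is multiplicative and bijective.  At other objects a factor is
  zero, and with it both sides.\<close>

lemma conjugated_entry_multiplier:
  assumes t: "t \<in> mor G" and y: "y \<in> ob_dom A (ginv G t)" and q: "q \<in> ob_dom A (ginv G t)"
    and h: "h \<in> Idl A (src G t) y q"
  shows "entry_multiplier R (ideal_semicat C A t) (ob_act A t y) (ob_act A t q)
    (conj_left t y q h) (conj_right t y q h)"
proof -
  interpret I: r_semicategory R "ideal_semicat C A t" by (rule ideal_r_semicategory[OF t])
  let ?i = "ginv G t" and ?y = "ob_act A t y" and ?q = "ob_act A t q"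
  let ?inv = "ob_act A (ginv G t)"
  have i: "?i \<in> mor G" "tgt G ?i = src G t" using t by (auto simp: ginv_simps)
  have yq: "?y \<in> ob_dom A t" "?q \<in> ob_dom A t" "?y \<in> Obj C" "?q \<in> Obj C"
      "y \<in> Obj C" "q \<in> Obj C" "?inv ?y = y" "?inv ?q = q"
    using t y q i point_in_dom point_inv_cancel ob_in_Obj by auto
  note m_dom = point_inv_in_dom[OF t] and m_ob = ob_in_Obj[OF i(1) point_inv_in_dom[OF t]]
    and cancel = point_cancel_inv[OF t]
  have hC: "h \<in> carrier (Hom C y q)"
    using module.submoduleE(1)[OF hom_module Idl_tgt_submodule[OF i(1)]] yq h i by auto
  note hom = Idl_subset_hom[OF t] and homi = Idl_subset_hom[OF i(1)]
  \<comment> \<open>Pulling back along \<open>t\<close>, then composing with \<open>h\<close>, stays in the ideal at the inverse.\<close>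
  have L: "Comp C y q (?inv v) h (act A ?i ?q v m) \<in> Idl A ?i y (?inv v)"
    if "v \<in> ob_dom A t" "m \<in> Idl A t ?q v" for v m
    using Idl_comp_left[OF i(1)] act_ginv_closed[OF t yq(2) that] that m_ob yq h i by simp
  have Rr: "Comp C (?inv u) y q (act A ?i u ?y m) h \<in> Idl A ?i (?inv u) q"
    if "u \<in> ob_dom A t" "m \<in> Idl A t u ?y" for u m
    using Idl_comp_right[OF i(1)] act_ginv_closed[OF t that(1) yq(1) that(2)] that m_ob yq h i by simp
  have lam_closed: "conj_left t y q h v m \<in> Idl A t ?y v" if "v \<in> Obj C" "m \<in> Idl A t ?q v" for v m
    using act_closed[OF t y m_dom L, of v m] that cancel yq Idl_zero_closed[OF t]
    by (auto simp: conj_left_def)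
  have rho_closed: "conj_right t y q h u m \<in> Idl A t u ?q" if "u \<in> Obj C" "m \<in> Idl A t u ?y" for u m
    using act_closed[OF t m_dom q Rr, of u m] that cancel yq Idl_zero_closed[OF t]
    by (auto simp: conj_right_def)
  have zz: "\<zero>\<^bsub>Hom C u v\<^esub> \<oplus>\<^bsub>Hom C u v\<^esub> \<zero>\<^bsub>Hom C u v\<^esub> = \<zero>\<^bsub>Hom C u v\<^esub>"
    if "u \<in> Obj C" "v \<in> Obj C" for u v
    using abelian_groupE(2,5)[OF hom_group[OF that]] by blast
  have inv_add: "act A ?i u v (m \<oplus>\<^bsub>Hom C u v\<^esub> n)
      = act A ?i u v m \<oplus>\<^bsub>Hom C (?inv u) (?inv v)\<^esub> act A ?i u v n"
    if "u \<in> ob_dom A t" "v \<in> ob_dom A t" "m \<in> Idl A t u v" "n \<in> Idl A t u v" for u v m n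
    using act_ginv_additive[OF t that(1,2)] that by (simp add: additive_maps_def hom_def)
  note ic = act_ginv_closed[OF t]
  show ?thesis
  proof (unfold_locales, unfold ideal_semicat_simps)
    show "?y \<in> Obj C" "?q \<in> Obj C" using yq by auto
  next
    fix v assume v: "v \<in> Obj C"
    have "conj_left t y q h v (m \<oplus>\<^bsub>Hom C ?q v\<^esub> n)
        = conj_left t y q h v m \<oplus>\<^bsub>Hom C ?y v\<^esub> conj_left t y q h v n"
      if mn: "m \<in> Idl A t ?q v" "n \<in> Idl A t ?q v" for m n
    proof (cases "v \<in> ob_dom A t")
      case True
      have "Comp C y q (?inv v) h (act A ?i ?q v (m \<oplus>\<^bsub>Hom C ?q v\<^esub> n))
          = Comp C y q (?inv v) h (act A ?i ?q v m)
            \<oplus>\<^bsub>Hom C y (?inv v)\<^esub> Comp C y q (?inv v) h (act A ?i ?q v n)"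
        using inv_add[OF yq(2) True mn] comp_add_right[OF yq(5,6) m_ob[OF True] hC] yq
          homi[OF yq(6) m_ob[OF True]] ic[OF yq(2) True mn(1)] ic[OF yq(2) True mn(2)] by simp
      then show ?thesis
        using True act_add[OF t y m_dom[OF True] L[OF True mn(1)] L[OF True mn(2)]] cancel
        by (simp add: conj_left_def)
    qed (use zz yq v in \<open>simp add: conj_left_def\<close>)
    then show "conj_left t y q h v
        \<in> additive_maps (Hom (ideal_semicat C A t) ?q v) (Hom (ideal_semicat C A t) ?y v)"
      using lam_closed v by (simp add: additive_maps_def hom_def Pi_def)
  next
    fix u assume u: "u \<in> Obj C"
    have "conj_right t y q h u (m \<oplus>\<^bsub>Hom C u ?y\<^esub> n)
        = conj_right t y q h u m \<oplus>\<^bsub>Hom C u ?q\<^esub> conj_right t y q h u n"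
      if mn: "m \<in> Idl A t u ?y" "n \<in> Idl A t u ?y" for m n
    proof (cases "u \<in> ob_dom A t")
      case True
      have "Comp C (?inv u) y q (act A ?i u ?y (m \<oplus>\<^bsub>Hom C u ?y\<^esub> n)) h
          = Comp C (?inv u) y q (act A ?i u ?y m) h
            \<oplus>\<^bsub>Hom C (?inv u) q\<^esub> Comp C (?inv u) y q (act A ?i u ?y n) h"
        using inv_add[OF True yq(1) mn] comp_add_left[OF m_ob[OF True] yq(5,6) _ _ hC] yq
          homi[OF m_ob[OF True] yq(5)] ic[OF True yq(1) mn(1)] ic[OF True yq(1) mn(2)] by simp
      then show ?thesis
        using True act_add[OF t m_dom[OF True] q Rr[OF True mn(1)] Rr[OF True mn(2)]] cancel
        by (simp add: conj_right_def)
    qed (use zz yq u in \<open>simp add: conj_right_def\<close>)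
    then show "conj_right t y q h u
        \<in> additive_maps (Hom (ideal_semicat C A t) u ?y) (Hom (ideal_semicat C A t) u ?q)"
      using rho_closed u by (simp add: additive_maps_def hom_def Pi_def)
  next
    fix v w f l assume vw: "v \<in> Obj C" "w \<in> Obj C" and f: "f \<in> Idl A t ?q v" and l: "l \<in> Idl A t v w"
    show "conj_left t y q h w (Comp C ?q v w f l) = Comp C ?y v w (conj_left t y q h v f) l"
    proof (cases "v \<in> ob_dom A t \<and> w \<in> ob_dom A t")
      case True
      then have d: "v \<in> ob_dom A t" "w \<in> ob_dom A t" by auto
      let ?f = "act A ?i ?q v f" and ?l = "act A ?i v w l"
      have f': "?f \<in> Idl A ?i q (?inv v)" and l': "?l \<in> Idl A ?i (?inv v) (?inv w)"
        using ic[OF yq(2) d(1) f] ic[OF d l] yq by auto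
      have "conj_left t y q h w (Comp C ?q v w f l)
          = act A t y (?inv w) (Comp C y q (?inv w) h (Comp C q (?inv v) (?inv w) ?f ?l))"
        using d act_ginv_mult[OF t yq(2) d f l] yq by (simp add: conj_left_def)
      also have "\<dots> = act A t y (?inv w) (Comp C y (?inv v) (?inv w) (Comp C y q (?inv v) h ?f) ?l)"
        using comp_assoc_hom[OF yq(5,6) m_ob[OF d(1)] m_ob[OF d(2)] hC] f' l' homi m_ob d yq by simp
      also have "\<dots> = Comp C ?y v w (act A t y (?inv v) (Comp C y q (?inv v) h ?f)) l"
        using act_mult[OF t y m_dom[OF d(1)] m_dom[OF d(2)] L[OF d(1) f] l'] cancel d
          act_act_ginv[OF t d(2,1) l] by simp
      finally show ?thesis using d by (simp add: conj_left_def)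
    next
      case False
      have l0: "l = \<zero>\<^bsub>Hom C v w\<^esub>" using Idl_vanish[OF t vw l] False by blast
      then have "Comp C ?q v w f l = \<zero>\<^bsub>Hom C ?q w\<^esub>"
        using comp_zero_right[OF yq(4) vw] hom[OF yq(4) vw(1) f] by simp
      moreover have "Comp C ?y v w (conj_left t y q h v f) l = \<zero>\<^bsub>Hom C ?y w\<^esub>"
        using l0 comp_zero_right[OF yq(3) vw] hom[OF yq(3) vw(1) lam_closed[OF vw(1) f]] by simp
      moreover have "conj_left t y q h w \<zero>\<^bsub>Hom C ?q w\<^esub> = \<zero>\<^bsub>Hom C ?y w\<^esub>"
      proof (cases "w \<in> ob_dom A t")
        case w: True
        then show ?thesis
          using act_zero[OF i(1), of ?q w] act_zero[OF t y m_dom[OF w]] yq t cancel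
            comp_zero_right[OF yq(5,6) m_ob[OF w] hC]
          by (simp add: conj_left_def ginv_ginv)
      qed (simp add: conj_left_def)
      ultimately show ?thesis by simp
    qed
  next
    fix u v f l assume uv: "u \<in> Obj C" "v \<in> Obj C" and f: "f \<in> Idl A t u v" and l: "l \<in> Idl A t v ?y"
    show "conj_right t y q h u (Comp C u v ?y f l) = Comp C u v ?q f (conj_right t y q h v l)"
    proof (cases "u \<in> ob_dom A t \<and> v \<in> ob_dom A t")
      case True
      then have d: "u \<in> ob_dom A t" "v \<in> ob_dom A t" by auto
      let ?f = "act A ?i u v f" and ?l = "act A ?i v ?y l"
      have f': "?f \<in> Idl A ?i (?inv u) (?inv v)" and l': "?l \<in> Idl A ?i (?inv v) y"
        using ic[OF d(2) yq(1) l] ic[OF d f] yq by auto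
      have "conj_right t y q h u (Comp C u v ?y f l)
          = act A t (?inv u) q (Comp C (?inv u) y q (Comp C (?inv u) (?inv v) y ?f ?l) h)"
        using d act_ginv_mult[OF t d yq(1) f l] yq by (simp add: conj_right_def)
      also have "\<dots> = act A t (?inv u) q (Comp C (?inv u) (?inv v) q ?f (Comp C (?inv v) y q ?l h))"
        using comp_assoc_hom[OF m_ob[OF d(1)] m_ob[OF d(2)] yq(5,6) _ _ hC] f' l' homi m_ob d yq
        by simp
      also have "\<dots> = Comp C u v ?q f (act A t (?inv v) q (Comp C (?inv v) y q ?l h))"
        using act_mult[OF t m_dom[OF d(1)] m_dom[OF d(2)] q f' Rr[OF d(2) l]] cancel d
          act_act_ginv[OF t d(2,1) f] by simp
      finally show ?thesis using d by (simp add: conj_right_def)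
    next
      case False
      have f0: "f = \<zero>\<^bsub>Hom C u v\<^esub>" using Idl_vanish[OF t uv f] False by blast
      then have "Comp C u v ?y f l = \<zero>\<^bsub>Hom C u ?y\<^esub>"
        using comp_zero_left[OF uv yq(3)] hom[OF uv(2) yq(3) l] by simp
      moreover have "Comp C u v ?q f (conj_right t y q h v l) = \<zero>\<^bsub>Hom C u ?q\<^esub>"
        using f0 comp_zero_left[OF uv yq(4)] hom[OF uv(2) yq(4) rho_closed[OF uv(2) l]] by simp
      moreover have "conj_right t y q h u \<zero>\<^bsub>Hom C u ?y\<^esub> = \<zero>\<^bsub>Hom C u ?q\<^esub>"
      proof (cases "u \<in> ob_dom A t")
        case u: True
        then show ?thesis
          using act_zero[OF i(1), of u ?y] act_zero[OF t m_dom[OF u] q] yq t cancel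
            comp_zero_left[OF m_ob[OF u] yq(5,6) hC]
          by (simp add: conj_right_def ginv_ginv)
      qed (simp add: conj_right_def)
      ultimately show ?thesis by simp
    qed
  next
    fix u v f l assume uv: "u \<in> Obj C" "v \<in> Obj C" and f: "f \<in> Idl A t u ?y" and l: "l \<in> Idl A t ?q v"
    note fr = hom[OF uv(1) yq(4) rho_closed[OF uv(1) f]] and ll = hom[OF yq(3) uv(2) lam_closed[OF uv(2) l]]
    show "Comp C u ?q v (conj_right t y q h u f) l = Comp C u ?y v f (conj_left t y q h v l)"
    proof (cases "u \<in> ob_dom A t")
      case u: True
      show ?thesis
      proof (cases "v \<in> ob_dom A t")
        case v: True
        let ?f = "act A ?i u ?y f" and ?l = "act A ?i ?q v l"
        have f': "?f \<in> Idl A ?i (?inv u) y" and l': "?l \<in> Idl A ?i q (?inv v)"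
          using ic[OF u yq(1) f] ic[OF yq(2) v l] yq by auto
        have "Comp C u ?q v (conj_right t y q h u f) l
            = act A t (?inv u) (?inv v) (Comp C (?inv u) q (?inv v) (Comp C (?inv u) y q ?f h) ?l)"
          using act_mult[OF t m_dom[OF u] q m_dom[OF v] Rr[OF u f] l'] cancel u v
            act_act_ginv[OF t v yq(2) l] yq by (simp add: conj_right_def)
        also have "\<dots> = act A t (?inv u) (?inv v)
            (Comp C (?inv u) y (?inv v) ?f (Comp C y q (?inv v) h ?l))"
          using comp_assoc_hom[OF m_ob[OF u] yq(5,6) m_ob[OF v] _ hC] f' l' homi m_ob u v yq by simp
        also have "\<dots> = Comp C u ?y v f (conj_left t y q h v l)"
          using act_mult[OF t m_dom[OF u] y m_dom[OF v] f' L[OF v l]] cancel u v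
            act_act_ginv[OF t yq(1) u f] yq by (simp add: conj_left_def)
        finally show ?thesis .
      next
        case v: False
        have "l = \<zero>\<^bsub>Hom C ?q v\<^esub>" using Idl_vanish[OF t yq(4) uv(2) l] v by blast
        then show ?thesis
          using v comp_zero_right[OF uv(1) yq(4) uv(2) fr] comp_zero_right[OF uv(1) yq(3) uv(2)]
            hom[OF uv(1) yq(3) f] by (simp add: conj_left_def)
      qed
    next
      case u: False
      have "f = \<zero>\<^bsub>Hom C u ?y\<^esub>" using Idl_vanish[OF t uv(1) yq(3) f] u by blast
      then show ?thesis
        using u comp_zero_left[OF uv(1) yq(3) uv(2) ll] comp_zero_left[OF uv(1) yq(4) uv(2)]
          hom[OF yq(4) uv(2) l] by (simp add: conj_right_def)
    qed
  qed
qed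

text \<open>Here the hypothesis on the ideals enters: the two multipliers above commute.\<close>

lemma conj_right_comp:
  assumes LR: "LR_associative (ideal_semicat C A t)"
    and t: "t \<in> mor G" and w: "w \<in> Obj C" and z: "z \<in> Obj C"
    and y: "y \<in> ob_dom A (ginv G t)" and q: "q \<in> ob_dom A (ginv G t)"
    and f: "f \<in> Idl A (tgt G t) w z" and l: "l \<in> Idl A t z (ob_act A t y)"
    and h: "h \<in> Idl A (src G t) y q"
  shows "conj_right t y q h w (Comp C w z (ob_act A t y) f l)
    = Comp C w z (ob_act A t q) f (conj_right t y q h z l)"
  using LR_associative_entry_multipliers[OF LR composition_entry_multiplier[OF t w z f]
      conjugated_entry_multiplier[OF t y q h]] l by simp


section \<open>The skew groupoid semicategory\<close>

lemma skew_summand_simps [simp]: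
  "carrier (skew_summand C A y x g) = Idl A g y (ob_act A g x)"
  "zero (skew_summand C A y x g) = zero (Hom C y (ob_act A g x))"
  "add (skew_summand C A y x g) = add (Hom C y (ob_act A g x))"
  by (simp_all add: skew_summand_def)

lemma star_iff: "g \<in> star G A x \<longleftrightarrow> g \<in> mor G \<and> x \<in> ob_dom A (ginv G g)"
  by (simp add: star_def)

lemma star_act_in_dom: "g \<in> star G A x \<Longrightarrow> ob_act A g x \<in> ob_dom A g"
  by (simp add: star_iff point_in_dom)

lemma star_act_in_Obj: "g \<in> star G A x \<Longrightarrow> ob_act A g x \<in> Obj C"
  using star_act_in_dom ob_in_Obj by (auto simp: star_iff)

lemma summand_group:
  "\<lbrakk>y \<in> Obj C; g \<in> star G A x\<rbrakk> \<Longrightarrow> abelian_group (skew_summand C A y x g)"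
  using Idl_group star_act_in_Obj by (simp add: skew_summand_def star_iff)

lemma skew_hom_group: "y \<in> Obj C \<Longrightarrow> abelian_group (skew_hom C G A y x)"
  unfolding skew_hom_def by (rule direct_sum_group) (rule summand_group)

definition skew_prod :: "'g \<Rightarrow> 'o \<Rightarrow> 'o \<Rightarrow> 'o \<Rightarrow> 'm \<Rightarrow> 'm \<Rightarrow> 'm" where
  "skew_prod t z y q f l =
     act A t (ob_act A (ginv G t) z) q
       (Comp C (ob_act A (ginv G t) z) y q (act A (ginv G t) z (ob_act A t y) f) l)"

definition skew_defined :: "'g \<Rightarrow> 'g \<Rightarrow> 'o \<Rightarrow> 'o \<Rightarrow> bool" where
  "skew_defined t g z x \<longleftrightarrow>
     composable G t g \<and> x \<in> ob_dom A (ginv G (gcomp G t g)) \<and> z \<in> ob_dom A t"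

lemma skew_comp_hom_eq:
  "skew_comp_hom C G A z y x t g f l =
    (if skew_defined t g z x
     then ds_incl (star G A x) (skew_summand C A z x) (gcomp G t g)
       (skew_prod t z y (ob_act A g x) f l)
     else \<zero>\<^bsub>skew_hom C G A z x\<^esub>)"
  by (simp add: skew_comp_hom_def skew_defined_def skew_prod_def Let_def)

lemma skew_defined_points:
  assumes "skew_defined t g z x" "g \<in> star G A x"
  shows "t \<in> mor G" "g \<in> mor G" "ob_act A g x \<in> ob_dom A (ginv G t)"
    "ob_act A g x \<in> ob_dom A g" "ob_act A t (ob_act A g x) = ob_act A (gcomp G t g) x"
    "gcomp G t g \<in> star G A x" "z \<in> ob_dom A t"
    "ob_act A (ginv G t) z \<in> ob_dom A (ginv G t)" "ob_act A t (ob_act A (ginv G t) z) = z"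
proof -
  have c: "composable G t g" "x \<in> ob_dom A (ginv G (gcomp G t g))" and z: "z \<in> ob_dom A t"
    and x: "x \<in> ob_dom A (ginv G g)"
    using assms by (auto simp: skew_defined_def star_iff)
  then show t: "t \<in> mor G" and g: "g \<in> mor G" by (auto simp: composable_def)
  show d: "ob_act A g x \<in> ob_dom A (ginv G t)"
    using point_in_dom_iff[OF c(1) x] c by simp
  show "ob_act A g x \<in> ob_dom A g" using point_in_dom g x by simp
  show "ob_act A t (ob_act A g x) = ob_act A (gcomp G t g) x"
    using point_comp[OF c(1) x d] .
  show "gcomp G t g \<in> star G A x" using c comp_mor by (simp add: star_iff)
  show "z \<in> ob_dom A t" by (rule z)
  show "ob_act A (ginv G t) z \<in> ob_dom A (ginv G t)" "ob_act A t (ob_act A (ginv G t) z) = z"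
    using point_inv_in_dom point_cancel_inv t z by auto
qed

text \<open>For objects in the domains of both ideals this is \<open>act_dom\<close> for the inverses of \<open>g\<close> and \<open>t\<close>, whose
  composite has the inverse \<open>t g\<close>.  Elsewhere the ideal at \<open>g\<close>, and with it \<open>m\<close>, is zero.\<close>

lemma act_into_composite:
  assumes c: "composable G t g" and u: "u \<in> ob_dom A (ginv G t)" and v: "v \<in> ob_dom A (ginv G t)"
    and m: "m \<in> Idl A (ginv G t) u v" "m \<in> Idl A g u v"
  shows "act A t u v m \<in> Idl A (gcomp G t g) (ob_act A t u) (ob_act A t v)"
proof -
  have t: "t \<in> mor G" and g: "g \<in> mor G" using c by (auto simp: composable_def)
  have i: "ginv G t \<in> mor G" using t by (simp add: ginv_simps)
  have ob: "u \<in> Obj C" "v \<in> Obj C" "ob_act A t u \<in> Obj C" "ob_act A t v \<in> Obj C"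
    using u v t i ob_in_Obj point_in_dom by blast+
  show ?thesis
  proof (cases "u \<in> ob_dom A g \<and> v \<in> ob_dom A g")
    case True
    have "ginv G (gcomp G (ginv G g) (ginv G t)) = gcomp G t g"
      if "composable G (ginv G g) (ginv G t)"
      using that t g by (simp add: ginv_gcomp ginv_ginv)
    with act_dom[OF composable_ginv_ginv[OF c], of v u] u v m True t g composable_ginv_ginv[OF c]
    show ?thesis by (auto simp: ginv_ginv)
  next
    case False
    then have "m = \<zero>\<^bsub>Hom C u v\<^esub>" using Idl_vanish g ob m by blast
    then show ?thesis
      using act_zero[OF t u v] Idl_zero_closed comp_mor[OF c] ob by simp
  qed
qed

lemma skew_prod_inner_closed:
  assumes y: "y \<in> Obj C" "t \<in> star G A y" and g: "g \<in> star G A x" and d: "skew_defined t g z x"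
    and f: "f \<in> Idl A t z (ob_act A t y)" and l: "l \<in> Idl A g y (ob_act A g x)"
  defines "f' \<equiv> act A (ginv G t) z (ob_act A t y) f"
    and "z' \<equiv> ob_act A (ginv G t) z"
  shows "f' \<in> Idl A (ginv G t) z' y"
    "Comp C z' y (ob_act A g x) f' l \<in> Idl A (ginv G t) z' (ob_act A g x)"
    "Comp C z' y (ob_act A g x) f' l \<in> Idl A g z' (ob_act A g x)"
proof -
  note p = skew_defined_points[OF d g]
  have i: "ginv G t \<in> mor G" and e: "tgt G (ginv G t) = tgt G g"
    using p(1) d by (auto simp: ginv_simps skew_defined_def composable_def)
  have ob: "z' \<in> Obj C" "ob_act A g x \<in> Obj C"
    using ob_in_Obj[OF i] p by (auto simp: z'_def)
  show f': "f' \<in> Idl A (ginv G t) z' y"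
    using act_ginv_closed[OF p(1,7) star_act_in_dom[OF y(2)] f] point_inv_cancel[OF p(1)] y
    by (simp add: f'_def z'_def star_iff)
  show "Comp C z' y (ob_act A g x) f' l \<in> Idl A (ginv G t) z' (ob_act A g x)"
    using Idl_comp_right[OF i ob(1) y(1) ob(2) f'] Idl_subset_tgt[OF p(2) y(1) ob(2) l] e by simp
  show "Comp C z' y (ob_act A g x) f' l \<in> Idl A g z' (ob_act A g x)"
    using Idl_comp_left[OF p(2) ob(1) y(1) ob(2) _ l] Idl_subset_tgt[OF i ob(1) y(1) f'] e by simp
qed

lemma skew_prod_closed:
  assumes y: "y \<in> Obj C" "t \<in> star G A y" and g: "g \<in> star G A x" and d: "skew_defined t g z x"
    and f: "f \<in> Idl A t z (ob_act A t y)" and l: "l \<in> Idl A g y (ob_act A g x)"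
  shows "skew_prod t z y (ob_act A g x) f l
    \<in> Idl A (gcomp G t g) z (ob_act A (gcomp G t g) x)"
proof -
  note p = skew_defined_points[OF d g]
  have "composable G t g" using d by (simp add: skew_defined_def)
  from act_into_composite[OF this p(8,3) skew_prod_inner_closed(2,3)[OF assms]] p
  show ?thesis by (simp add: skew_prod_def)
qed

lemma skew_prod_add_left:
  assumes y: "y \<in> Obj C" "t \<in> star G A y" and g: "g \<in> star G A x" and d: "skew_defined t g z x"
    and f: "f \<in> Idl A t z (ob_act A t y)" "f' \<in> Idl A t z (ob_act A t y)"
    and l: "l \<in> Idl A g y (ob_act A g x)"
  shows "skew_prod t z y (ob_act A g x) (f \<oplus>\<^bsub>Hom C z (ob_act A t y)\<^esub> f') l
    = skew_prod t z y (ob_act A g x) f l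
      \<oplus>\<^bsub>Hom C z (ob_act A (gcomp G t g) x)\<^esub> skew_prod t z y (ob_act A g x) f' l"
proof -
  note p = skew_defined_points[OF d g]
  note c1 = skew_prod_inner_closed[OF y g d f(1) l] and c2 = skew_prod_inner_closed[OF y g d f(2) l]
  have i: "ginv G t \<in> mor G" using p(1) by (simp add: ginv_simps)
  let ?z = "ob_act A (ginv G t) z" and ?q = "ob_act A g x"
  have ob: "?z \<in> Obj C" "?q \<in> Obj C" using ob_in_Obj[OF i] p by auto
  have "act A (ginv G t) z (ob_act A t y) (f \<oplus>\<^bsub>Hom C z (ob_act A t y)\<^esub> f')
      = act A (ginv G t) z (ob_act A t y) f \<oplus>\<^bsub>Hom C ?z y\<^esub> act A (ginv G t) z (ob_act A t y) f'"
    using act_ginv_additive[OF p(1,7) star_act_in_dom[OF y(2)]] f point_inv_cancel[OF p(1)] y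
    by (simp add: additive_maps_def hom_def star_iff)
  then show ?thesis
    using comp_add_left[OF ob(1) y(1) ob(2)] Idl_subset_hom[OF i ob(1) y(1) c1(1)]
      Idl_subset_hom[OF i ob(1) y(1) c2(1)] Idl_subset_hom[OF p(2) y(1) ob(2) l]
      act_add[OF p(1,8,3) c1(2) c2(2)] p
    by (simp add: skew_prod_def)
qed

lemma skew_prod_add_right:
  assumes y: "y \<in> Obj C" "t \<in> star G A y" and g: "g \<in> star G A x" and d: "skew_defined t g z x"
    and f: "f \<in> Idl A t z (ob_act A t y)"
    and l: "l \<in> Idl A g y (ob_act A g x)" "l' \<in> Idl A g y (ob_act A g x)"
  shows "skew_prod t z y (ob_act A g x) f (l \<oplus>\<^bsub>Hom C y (ob_act A g x)\<^esub> l')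
    = skew_prod t z y (ob_act A g x) f l
      \<oplus>\<^bsub>Hom C z (ob_act A (gcomp G t g) x)\<^esub> skew_prod t z y (ob_act A g x) f l'"
proof -
  note p = skew_defined_points[OF d g]
  note c1 = skew_prod_inner_closed[OF y g d f l(1)] and c2 = skew_prod_inner_closed[OF y g d f l(2)]
  have i: "ginv G t \<in> mor G" using p(1) by (simp add: ginv_simps)
  let ?z = "ob_act A (ginv G t) z" and ?q = "ob_act A g x"
  have ob: "?z \<in> Obj C" "?q \<in> Obj C" using ob_in_Obj[OF i] p by auto
  show ?thesis
    using comp_add_right[OF ob(1) y(1) ob(2)] Idl_subset_hom[OF i ob(1) y(1) c1(1)]
      Idl_subset_hom[OF p(2) y(1) ob(2) l(1)] Idl_subset_hom[OF p(2) y(1) ob(2) l(2)]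
      act_add[OF p(1,8,3) c1(2) c2(2)] p
    by (simp add: skew_prod_def)
qed

lemma skew_comp_hom_closed:
  assumes "z \<in> Obj C" "y \<in> Obj C" "t \<in> star G A y" "g \<in> star G A x"
    and "f \<in> Idl A t z (ob_act A t y)" "l \<in> Idl A g y (ob_act A g x)"
  shows "skew_comp_hom C G A z y x t g f l \<in> carrier (skew_hom C G A z x)"
proof (cases "skew_defined t g z x")
  case True
  then show ?thesis
    using ds_incl_closed[of "star G A x" "skew_summand C A z x", OF summand_group]
      skew_prod_closed[OF assms(2-4) True] assms
    by (simp add: skew_comp_hom_eq skew_hom_def)
next
  case False
  then show ?thesis
    using abelian_groupE(2)[OF skew_hom_group] assms by (simp add: skew_comp_hom_eq)
qed

lemma skew_comp_hom_additive_left: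
  assumes "z \<in> Obj C" "y \<in> Obj C" "t \<in> star G A y" "g \<in> star G A x" "l \<in> Idl A g y (ob_act A g x)"
  shows "(\<lambda>f. skew_comp_hom C G A z y x t g f l)
    \<in> additive_maps (skew_summand C A z y t) (skew_hom C G A z x)"
proof -
  have "skew_comp_hom C G A z y x t g (f \<oplus>\<^bsub>Hom C z (ob_act A t y)\<^esub> f') l
    = skew_comp_hom C G A z y x t g f l \<oplus>\<^bsub>skew_hom C G A z x\<^esub> skew_comp_hom C G A z y x t g f' l"
    if f: "f \<in> Idl A t z (ob_act A t y)" "f' \<in> Idl A t z (ob_act A t y)" for f f'
  proof (cases "skew_defined t g z x")
    case True
    show ?thesis
      using True skew_prod_add_left[OF assms(2-4) True f assms(5)]
        ds_incl_additive[of "star G A x" "skew_summand C A z x", OF summand_group]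
        skew_prod_closed[OF assms(2-4) True f(1) assms(5)]
        skew_prod_closed[OF assms(2-4) True f(2) assms(5)] assms(1)
      by (simp add: skew_comp_hom_eq skew_hom_def)
  next
    case False
    then show ?thesis
      using abelian_groupE(2,5)[OF skew_hom_group[OF assms(1), of x]] by (simp add: skew_comp_hom_eq)
  qed
  then show ?thesis
    using skew_comp_hom_closed[OF assms(1-4) _ assms(5)] by (simp add: additive_maps_def hom_def Pi_def)
qed

lemma skew_comp_hom_additive_right:
  assumes "z \<in> Obj C" "y \<in> Obj C" "t \<in> star G A y" "g \<in> star G A x" "f \<in> Idl A t z (ob_act A t y)"
  shows "skew_comp_hom C G A z y x t g f
    \<in> additive_maps (skew_summand C A y x g) (skew_hom C G A z x)"
proof -
  have "skew_comp_hom C G A z y x t g f (l \<oplus>\<^bsub>Hom C y (ob_act A g x)\<^esub> l')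
    = skew_comp_hom C G A z y x t g f l \<oplus>\<^bsub>skew_hom C G A z x\<^esub> skew_comp_hom C G A z y x t g f l'"
    if l: "l \<in> Idl A g y (ob_act A g x)" "l' \<in> Idl A g y (ob_act A g x)" for l l'
  proof (cases "skew_defined t g z x")
    case True
    show ?thesis
      using True skew_prod_add_right[OF assms(2-4) True assms(5) l]
        ds_incl_additive[of "star G A x" "skew_summand C A z x", OF summand_group]
        skew_prod_closed[OF assms(2-4) True assms(5) l(1)]
        skew_prod_closed[OF assms(2-4) True assms(5) l(2)] assms(1)
      by (simp add: skew_comp_hom_eq skew_hom_def)
  next
    case False
    then show ?thesis
      using abelian_groupE(2,5)[OF skew_hom_group[OF assms(1), of x]] by (simp add: skew_comp_hom_eq)
  qed
  then show ?thesis
    using skew_comp_hom_closed[OF assms(1-5)] by (simp add: additive_maps_def hom_def Pi_def)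
qed

lemma skew_comp_hom_zero:
  assumes "z \<in> Obj C" "y \<in> Obj C" "t \<in> star G A y" "g \<in> star G A x"
  shows "l \<in> Idl A g y (ob_act A g x)
      \<Longrightarrow> skew_comp_hom C G A z y x t g \<zero>\<^bsub>Hom C z (ob_act A t y)\<^esub> l = \<zero>\<^bsub>skew_hom C G A z x\<^esub>"
    and "f \<in> Idl A t z (ob_act A t y)
      \<Longrightarrow> skew_comp_hom C G A z y x t g f \<zero>\<^bsub>Hom C y (ob_act A g x)\<^esub> = \<zero>\<^bsub>skew_hom C G A z x\<^esub>"
  using additive_zero[OF summand_group[OF assms(1,3)] skew_hom_group[OF assms(1)]
      skew_comp_hom_additive_left[OF assms]]
    additive_zero[OF summand_group[OF assms(2,4)] skew_hom_group[OF assms(1)]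
      skew_comp_hom_additive_right[OF assms]]
  by simp_all

abbreviation skew_comp :: "'o \<Rightarrow> 'o \<Rightarrow> 'o \<Rightarrow> ('g \<Rightarrow> 'm) \<Rightarrow> ('g \<Rightarrow> 'm) \<Rightarrow> 'g \<Rightarrow> 'm" where
  "skew_comp \<equiv> Comp (skew_semicat C G A)"

lemma skew_hom_entry:
  "\<lbrakk>u \<in> carrier (skew_hom C G A y x); g \<in> star G A x\<rbrakk> \<Longrightarrow> u g \<in> Idl A g y (ob_act A g x)"
  by (simp add: skew_hom_def direct_sum_carrier)

text \<open>The supports occurring in the definition of the composition change when a factor changes; sums
  over fixed larger sets make biadditivity a termwise statement.\<close>

lemma skew_comp_superset:
  assumes z: "z \<in> Obj C" and y: "y \<in> Obj C"
    and u: "u \<in> carrier (skew_hom C G A z y)" and v: "v \<in> carrier (skew_hom C G A y x)"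
    and T: "finite T" "T \<subseteq> star G A y" "ds_support (star G A y) (skew_summand C A z y) u \<subseteq> T"
    and S: "finite S" "S \<subseteq> star G A x" "ds_support (star G A x) (skew_summand C A y x) v \<subseteq> S"
  shows "skew_comp z y x u v = finsum (skew_hom C G A z x)
    (\<lambda>(t, g). skew_comp_hom C G A z y x t g (u t) (v g)) (T \<times> S)"
proof -
  interpret abelian_group "skew_hom C G A z x" using skew_hom_group z by simp
  have cl: "skew_comp_hom C G A z y x t g (u t) (v g) \<in> carrier (skew_hom C G A z x)"
    if "t \<in> T" "g \<in> S" for t g
    using that T S skew_comp_hom_closed[OF z y] skew_hom_entry[OF u] skew_hom_entry[OF v] by blast
  have "skew_comp_hom C G A z y x t g (u t) (v g) = \<zero>\<^bsub>skew_hom C G A z x\<^esub>"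
    if "(t, g) \<in> T \<times> S - ds_support (star G A y) (skew_summand C A z y) u
      \<times> ds_support (star G A x) (skew_summand C A y x) v" for t g
  proof -
    have tg: "t \<in> star G A y" "g \<in> star G A x" using that T S by auto
    then have "u t = \<zero>\<^bsub>Hom C z (ob_act A t y)\<^esub> \<or> v g = \<zero>\<^bsub>Hom C y (ob_act A g x)\<^esub>"
      using that by (auto simp: ds_support_def)
    then show ?thesis
      using skew_comp_hom_zero[OF z y tg] skew_hom_entry[OF u tg(1)] skew_hom_entry[OF v tg(2)] by auto
  qed
  then show ?thesis
    unfolding skew_semicat_def
    by simp (rule finsum_superset, use T S cl in auto)
qed

lemma skew_support_finite:
  "u \<in> carrier (skew_hom C G A y x) \<Longrightarrow> finite (ds_support (star G A x) (skew_summand C A y x) u)"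
  by (simp add: skew_hom_def direct_sum_carrier ds_support_def)

lemma skew_comp_closed:
  assumes z: "z \<in> Obj C" and y: "y \<in> Obj C"
    and u: "u \<in> carrier (skew_hom C G A z y)" and v: "v \<in> carrier (skew_hom C G A y x)"
  shows "skew_comp z y x u v \<in> carrier (skew_hom C G A z x)"
proof -
  interpret abelian_group "skew_hom C G A z x" using skew_hom_group z by simp
  show ?thesis
    unfolding skew_semicat_def
    by simp (rule finsum_closed, auto simp: ds_support_def
      intro!: skew_comp_hom_closed[OF z y] skew_hom_entry[OF u] skew_hom_entry[OF v])
qed

lemma skew_hom_add_entry:
  "g \<in> star G A x \<Longrightarrow> (u \<oplus>\<^bsub>skew_hom C G A y x\<^esub> v) g = u g \<oplus>\<^bsub>Hom C y (ob_act A g x)\<^esub> v g"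
  by (simp add: skew_hom_def direct_sum_simps)

lemma skew_support_add:
  assumes "y \<in> Obj C"
  shows "ds_support (star G A x) (skew_summand C A y x) (u \<oplus>\<^bsub>skew_hom C G A y x\<^esub> v)
    \<subseteq> ds_support (star G A x) (skew_summand C A y x) u
      \<union> ds_support (star G A x) (skew_summand C A y x) v"
proof -
  have "\<zero>\<^bsub>Hom C y (ob_act A g x)\<^esub> \<oplus>\<^bsub>Hom C y (ob_act A g x)\<^esub> \<zero>\<^bsub>Hom C y (ob_act A g x)\<^esub>
      = \<zero>\<^bsub>Hom C y (ob_act A g x)\<^esub>" if "g \<in> star G A x" for g
    using abelian_groupE(2,5)[OF hom_group[OF assms star_act_in_Obj[OF that]]] by blast
  then show ?thesis by (auto simp: ds_support_def skew_hom_add_entry)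
qed

lemma skew_comp_add_left:
  assumes z: "z \<in> Obj C" and y: "y \<in> Obj C"
    and u: "u \<in> carrier (skew_hom C G A z y)" "u' \<in> carrier (skew_hom C G A z y)"
    and v: "v \<in> carrier (skew_hom C G A y x)"
  shows "skew_comp z y x (u \<oplus>\<^bsub>skew_hom C G A z y\<^esub> u') v
    = skew_comp z y x u v \<oplus>\<^bsub>skew_hom C G A z x\<^esub> skew_comp z y x u' v"
proof -
  interpret abelian_group "skew_hom C G A z x" using skew_hom_group z by simp
  let ?sup = "ds_support (star G A y) (skew_summand C A z y)"
  let ?T = "?sup u \<union> ?sup u'" and ?S = "ds_support (star G A x) (skew_summand C A y x) v"
  let ?B = "\<lambda>w (t, g). skew_comp_hom C G A z y x t g (w t) (v g)"
  have fin: "finite ?T" "?T \<subseteq> star G A y" "finite ?S" "?S \<subseteq> star G A x"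
    using skew_support_finite[OF u(1)] skew_support_finite[OF u(2)] skew_support_finite[OF v]
    by (auto simp: ds_support_def)
  have uu: "u \<oplus>\<^bsub>skew_hom C G A z y\<^esub> u' \<in> carrier (skew_hom C G A z y)"
    using abelian_groupE(1)[OF skew_hom_group] z u by blast
  have cl: "?B w \<in> ?T \<times> ?S \<rightarrow> carrier (skew_hom C G A z x)"
    if "w \<in> carrier (skew_hom C G A z y)" for w
    using fin(2,4) skew_comp_hom_closed[OF z y] skew_hom_entry[OF that] skew_hom_entry[OF v]
    by (auto simp: subset_iff)
  have "skew_comp z y x (u \<oplus>\<^bsub>skew_hom C G A z y\<^esub> u') v
      = finsum (skew_hom C G A z x) (?B (u \<oplus>\<^bsub>skew_hom C G A z y\<^esub> u')) (?T \<times> ?S)"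
    by (rule skew_comp_superset[OF z y uu v fin(1,2) skew_support_add[OF z] fin(3,4)]) simp
  also have "\<dots> = finsum (skew_hom C G A z x)
      (\<lambda>i. ?B u i \<oplus>\<^bsub>skew_hom C G A z x\<^esub> ?B u' i) (?T \<times> ?S)"
  proof (rule finsum_cong')
    show "(\<lambda>i. ?B u i \<oplus>\<^bsub>skew_hom C G A z x\<^esub> ?B u' i) \<in> ?T \<times> ?S \<rightarrow> carrier (skew_hom C G A z x)"
      using cl[OF u(1)] cl[OF u(2)] by (intro funcsetI a_closed) (auto simp: Pi_def)
  next
    fix i assume i: "i \<in> ?T \<times> ?S"
    obtain t g where tg: "i = (t, g)" by (cases i)
    then have s: "t \<in> star G A y" "g \<in> star G A x" using i fin(2,4) by auto
    show "?B (u \<oplus>\<^bsub>skew_hom C G A z y\<^esub> u') i = ?B u i \<oplus>\<^bsub>skew_hom C G A z x\<^esub> ?B u' i"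
      using skew_comp_hom_additive_left[OF z y s skew_hom_entry[OF v s(2)]]
        skew_hom_entry[OF u(1) s(1)] skew_hom_entry[OF u(2) s(1)]
      by (simp add: tg skew_hom_add_entry[OF s(1)] additive_maps_def hom_def)
  qed simp
  also have "\<dots> = finsum (skew_hom C G A z x) (?B u) (?T \<times> ?S)
      \<oplus>\<^bsub>skew_hom C G A z x\<^esub> finsum (skew_hom C G A z x) (?B u') (?T \<times> ?S)"
    by (rule finsum_addf[OF cl[OF u(1)] cl[OF u(2)]])
  also have "finsum (skew_hom C G A z x) (?B u) (?T \<times> ?S) = skew_comp z y x u v"
    by (rule skew_comp_superset[OF z y u(1) v fin(1,2) _ fin(3,4), symmetric]) auto
  also have "finsum (skew_hom C G A z x) (?B u') (?T \<times> ?S) = skew_comp z y x u' v"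
    by (rule skew_comp_superset[OF z y u(2) v fin(1,2) _ fin(3,4), symmetric]) auto
  finally show ?thesis .
qed

lemma skew_comp_add_right:
  assumes z: "z \<in> Obj C" and y: "y \<in> Obj C"
    and u: "u \<in> carrier (skew_hom C G A z y)"
    and v: "v \<in> carrier (skew_hom C G A y x)" "v' \<in> carrier (skew_hom C G A y x)"
  shows "skew_comp z y x u (v \<oplus>\<^bsub>skew_hom C G A y x\<^esub> v')
    = skew_comp z y x u v \<oplus>\<^bsub>skew_hom C G A z x\<^esub> skew_comp z y x u v'"
proof -
  interpret abelian_group "skew_hom C G A z x" using skew_hom_group z by simp
  let ?sup = "ds_support (star G A x) (skew_summand C A y x)"
  let ?T = "ds_support (star G A y) (skew_summand C A z y) u" and ?S = "?sup v \<union> ?sup v'"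
  let ?B = "\<lambda>w (t, g). skew_comp_hom C G A z y x t g (u t) (w g)"
  have fin: "finite ?T" "?T \<subseteq> star G A y" "finite ?S" "?S \<subseteq> star G A x"
    using skew_support_finite[OF v(1)] skew_support_finite[OF v(2)] skew_support_finite[OF u]
    by (auto simp: ds_support_def)
  have vv: "v \<oplus>\<^bsub>skew_hom C G A y x\<^esub> v' \<in> carrier (skew_hom C G A y x)"
    using abelian_groupE(1)[OF skew_hom_group] y v by blast
  have cl: "?B w \<in> ?T \<times> ?S \<rightarrow> carrier (skew_hom C G A z x)"
    if "w \<in> carrier (skew_hom C G A y x)" for w
    using fin(2,4) skew_comp_hom_closed[OF z y] skew_hom_entry[OF that] skew_hom_entry[OF u]
    by (auto simp: subset_iff)
  have "skew_comp z y x u (v \<oplus>\<^bsub>skew_hom C G A y x\<^esub> v')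
      = finsum (skew_hom C G A z x) (?B (v \<oplus>\<^bsub>skew_hom C G A y x\<^esub> v')) (?T \<times> ?S)"
    by (rule skew_comp_superset[OF z y u vv fin(1,2) _ fin(3,4) skew_support_add[OF y]]) simp
  also have "\<dots> = finsum (skew_hom C G A z x)
      (\<lambda>i. ?B v i \<oplus>\<^bsub>skew_hom C G A z x\<^esub> ?B v' i) (?T \<times> ?S)"
  proof (rule finsum_cong')
    show "(\<lambda>i. ?B v i \<oplus>\<^bsub>skew_hom C G A z x\<^esub> ?B v' i) \<in> ?T \<times> ?S \<rightarrow> carrier (skew_hom C G A z x)"
      using cl[OF v(1)] cl[OF v(2)] by (intro funcsetI a_closed) (auto simp: Pi_def)
  next
    fix i assume i: "i \<in> ?T \<times> ?S"
    obtain t g where tg: "i = (t, g)" by (cases i)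
    then have s: "t \<in> star G A y" "g \<in> star G A x" using i fin(2,4) by auto
    show "?B (v \<oplus>\<^bsub>skew_hom C G A y x\<^esub> v') i = ?B v i \<oplus>\<^bsub>skew_hom C G A z x\<^esub> ?B v' i"
      using skew_comp_hom_additive_right[OF z y s skew_hom_entry[OF u s(1)]]
        skew_hom_entry[OF v(1) s(2)] skew_hom_entry[OF v(2) s(2)]
      by (simp add: tg skew_hom_add_entry[OF s(2)] additive_maps_def hom_def)
  qed simp
  also have "\<dots> = finsum (skew_hom C G A z x) (?B v) (?T \<times> ?S)
      \<oplus>\<^bsub>skew_hom C G A z x\<^esub> finsum (skew_hom C G A z x) (?B v') (?T \<times> ?S)"
    by (rule finsum_addf[OF cl[OF v(1)] cl[OF v(2)]])
  also have "finsum (skew_hom C G A z x) (?B v) (?T \<times> ?S) = skew_comp z y x u v"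
    by (rule skew_comp_superset[OF z y u v(1) fin(1,2) _ fin(3,4), symmetric]) auto
  also have "finsum (skew_hom C G A z x) (?B v') (?T \<times> ?S) = skew_comp z y x u v'"
    by (rule skew_comp_superset[OF z y u v(2) fin(1,2) _ fin(3,4), symmetric]) auto
  finally show ?thesis .
qed

lemma skew_comp_zero_left:
  assumes "z \<in> Obj C" "y \<in> Obj C" "v \<in> carrier (skew_hom C G A y x)"
  shows "skew_comp z y x \<zero>\<^bsub>skew_hom C G A z y\<^esub> v = \<zero>\<^bsub>skew_hom C G A z x\<^esub>"
proof -
  have "(\<lambda>u. skew_comp z y x u v) \<in> additive_maps (skew_hom C G A z y) (skew_hom C G A z x)"
    using assms skew_comp_closed skew_comp_add_left by (simp add: additive_maps_def hom_def Pi_def)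
  from additive_zero[OF skew_hom_group skew_hom_group this] assms show ?thesis by simp
qed

lemma skew_comp_zero_right:
  assumes "z \<in> Obj C" "y \<in> Obj C" "u \<in> carrier (skew_hom C G A z y)"
  shows "skew_comp z y x u \<zero>\<^bsub>skew_hom C G A y x\<^esub> = \<zero>\<^bsub>skew_hom C G A z x\<^esub>"
proof -
  have "skew_comp z y x u \<in> additive_maps (skew_hom C G A y x) (skew_hom C G A z x)"
    using assms skew_comp_closed skew_comp_add_right by (simp add: additive_maps_def hom_def Pi_def)
  from additive_zero[OF skew_hom_group skew_hom_group this] assms show ?thesis by simp
qed

abbreviation skew_incl :: "'o \<Rightarrow> 'o \<Rightarrow> 'g \<Rightarrow> 'm \<Rightarrow> 'g \<Rightarrow> 'm" where
  "skew_incl y x \<equiv> ds_incl (star G A x) (skew_summand C A y x)"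

lemma skew_incl_closed:
  "\<lbrakk>y \<in> Obj C; f \<in> Idl A g y (ob_act A g x)\<rbrakk> \<Longrightarrow> skew_incl y x g f \<in> carrier (skew_hom C G A y x)"
  unfolding skew_hom_def by (rule ds_incl_closed) (auto intro: summand_group)

lemma skew_incl_zero: "skew_incl y x g \<zero>\<^bsub>Hom C y (ob_act A g x)\<^esub> = \<zero>\<^bsub>skew_hom C G A y x\<^esub>"
  using ds_incl_zero[of "star G A x" "skew_summand C A y x" g] by (simp add: skew_hom_def)

lemma skew_comp_incl:
  assumes z: "z \<in> Obj C" and y: "y \<in> Obj C" and t: "t \<in> star G A y" and g: "g \<in> star G A x"
    and f: "f \<in> Idl A t z (ob_act A t y)" and l: "l \<in> Idl A g y (ob_act A g x)"
  shows "skew_comp z y x (skew_incl z y t f) (skew_incl y x g l)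
    = skew_comp_hom C G A z y x t g f l"
proof -
  interpret abelian_group "skew_hom C G A z x" using skew_hom_group z by simp
  have "skew_comp z y x (skew_incl z y t f) (skew_incl y x g l) = finsum (skew_hom C G A z x)
    (\<lambda>(t', g'). skew_comp_hom C G A z y x t' g' (skew_incl z y t f t') (skew_incl y x g l g'))
    ({t} \<times> {g})"
    by (rule skew_comp_superset[OF z y skew_incl_closed[OF z f] skew_incl_closed[OF y l]])
      (use t g in \<open>auto simp: ds_support_def ds_incl_def split: if_splits\<close>)
  then show ?thesis
    using skew_comp_hom_closed[OF assms] t g by (simp add: ds_incl_def)
qed


section \<open>Associativity of the skew composition\<close>

text \<open>Read in its left argument, the skew product is the conjugated right multiplication, to which
  \<open>conj_right_comp\<close> applies.\<close>

lemma skew_prod_conj_right: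
  "z \<in> ob_dom A t \<Longrightarrow> skew_prod t z y q l h = conj_right t y q h z l"
  by (simp add: skew_prod_def conj_right_def)

text \<open>In \<open>(f l) h\<close> the factor \<open>f l\<close>, an image under \<open>s\<close>, is pulled back along the composite of \<open>s\<close> and
  \<open>t\<close>.  The part belonging to \<open>s\<close> cancels, and a pull-back along \<open>t\<close> remains.\<close>

lemma act_ginv_composite_skew_prod:
  assumes y: "y \<in> Obj C" "t \<in> star G A y" and z: "z \<in> Obj C" "s \<in> star G A z"
    and d: "skew_defined s t w y" and wst: "w \<in> ob_dom A (gcomp G s t)"
    and f: "f \<in> Idl A s w (ob_act A s z)" and l: "l \<in> Idl A t z (ob_act A t y)"
  defines "w' \<equiv> ob_act A (ginv G s) w"
  shows "act A (ginv G (gcomp G s t)) w (ob_act A (gcomp G s t) y)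
      (skew_prod s w z (ob_act A t y) f l)
    = act A (ginv G t) w' (ob_act A t y)
      (Comp C w' z (ob_act A t y) (act A (ginv G s) w (ob_act A s z) f) l)"
proof -
  note p = skew_defined_points[OF d y(2)]
  let ?p = "ob_act A t y" and ?k = "gcomp G s t"
  let ?m = "Comp C w' z ?p (act A (ginv G s) w (ob_act A s z) f) l"
  have c: "composable G s t" using d by (simp add: skew_defined_def)
  have k: "?k \<in> mor G" using comp_mor[OF c] .
  have ck: "composable G (ginv G ?k) s"
    using c p(1) k tgt_comp[OF c] by (simp add: composable_def ginv_simps)
  have ek: "gcomp G (ginv G ?k) s = ginv G t"
    using comp_ginv_cancel[OF composable_ginv_ginv[OF c]] p(1) ginv_gcomp[OF c] by (simp add: ginv_ginv)
  have m: "?m \<in> Idl A (ginv G s) w' ?p"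
    using skew_prod_inner_closed(2)[OF z y(2) d f l] by (simp add: w'_def)
  have w: "ob_act A s w' = w" using p by (simp add: w'_def)
  have e: "skew_prod s w z ?p f l = act A s w' ?p ?m" by (simp add: skew_prod_def w'_def)
  have in_s: "skew_prod s w z ?p f l \<in> Idl A s w (ob_act A s ?p)"
    using act_closed[OF p(1) _ p(3) m] p(8) w e by (simp add: w'_def)
  have in_k: "skew_prod s w z ?p f l \<in> Idl A ?k w (ob_act A s ?p)"
    using skew_prod_closed[OF z y(2) d f l] p(5) by simp
  have back_m: "act A (ginv G s) w (ob_act A s ?p) (skew_prod s w z ?p f l) = ?m"
    using ginv_act_act[OF p(1,3) _ m] p(8) w e by (simp add: w'_def)
  have kp: "ob_act A s ?p \<in> ob_dom A ?k" and sp: "ob_act A s ?p \<in> ob_dom A s"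
    using star_act_in_dom[OF p(6)] p(5) point_in_dom[OF p(1,3)] by simp_all
  have "act A (ginv G ?k) w (ob_act A s ?p) (act A s w' ?p ?m)
      = act A (gcomp G (ginv G ?k) s) w' ?p ?m"
  proof (rule act_comp[OF ck])
    show "ob_act A s ?p \<in> ob_dom A s \<inter> ob_dom A (ginv G (ginv G ?k))"
      "w \<in> ob_dom A s \<inter> ob_dom A (ginv G (ginv G ?k))"
      using kp sp wst p(7) k by (simp_all add: ginv_ginv)
    show "w' = ob_act A (ginv G s) w" by (simp add: w'_def)
    show "?p = ob_act A (ginv G s) (ob_act A s ?p)" using point_inv_cancel[OF p(1,3)] by simp
    show "?m \<in> act A (ginv G s) w (ob_act A s ?p)
        ` (Idl A s w (ob_act A s ?p) \<inter> Idl A (ginv G (ginv G ?k)) w (ob_act A s ?p))"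
      by (rule image_eqI[where x = "skew_prod s w z ?p f l"])
        (use back_m in_s in_k k in \<open>simp_all add: ginv_ginv\<close>)
  qed
  then show ?thesis using e p(5) ek by simp
qed

text \<open>If one product is nonzero, then the objects that \<open>f\<close>, \<open>l\<close>, \<open>h\<close> pass through lie in all the
  domains needed to form the other one.  In that case the two agree by \<open>conj_right_comp\<close> and the
  compatibility of the action with composites.\<close>

lemma skew_comp_assoc_homogeneous:
  assumes LR: "\<And>g. g \<in> mor G \<Longrightarrow> LR_associative (ideal_semicat C A g)"
    and w: "w \<in> Obj C" and z: "z \<in> Obj C" and y: "y \<in> Obj C" and x: "x \<in> Obj C"
    and s: "s \<in> star G A z" and t: "t \<in> star G A y" and g: "g \<in> star G A x"
    and f: "f \<in> Idl A s w (ob_act A s z)" and l: "l \<in> Idl A t z (ob_act A t y)"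
    and h: "h \<in> Idl A g y (ob_act A g x)"
  shows "skew_comp w y x (skew_comp w z y (skew_incl w z s f) (skew_incl z y t l)) (skew_incl y x g h)
    = skew_comp w z x (skew_incl w z s f) (skew_comp z y x (skew_incl z y t l) (skew_incl y x g h))"
    (is "?lhs = ?rhs")
proof (cases "z \<in> ob_dom A t")
  case False
  have tm: "t \<in> mor G" using t by (simp add: star_iff)
  have "l = \<zero>\<^bsub>Hom C z (ob_act A t y)\<^esub>"
    using Idl_vanish[OF tm z star_act_in_Obj[OF t] l] False by blast
  then show ?thesis
    using skew_incl_closed[OF w f] skew_incl_closed[OF y h] w z y
    by (simp add: skew_incl_zero skew_comp_zero_left skew_comp_zero_right)
next
  case zt: True
  let ?p = "ob_act A t y" and ?q = "ob_act A g x" and ?st = "gcomp G s t" and ?tg = "gcomp G t g"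
  let ?L = "skew_prod ?st w y ?q (skew_prod s w z ?p f l) h"
  let ?R = "skew_prod s w z (ob_act A ?tg x) f (skew_prod t z y ?q l h)"
  have mor: "s \<in> mor G" "t \<in> mor G" "g \<in> mor G" and dom: "z \<in> ob_dom A (ginv G s)"
      "y \<in> ob_dom A (ginv G t)" "x \<in> ob_dom A (ginv G g)"
    using s t g by (auto simp: star_iff)
  have lhs: "?lhs = (if skew_defined s t w y \<and> skew_defined ?st g w x
      then skew_incl w x (gcomp G ?st g) ?L else \<zero>\<^bsub>skew_hom C G A w x\<^esub>)"
    using skew_comp_incl[OF w z s t f l] skew_prod_closed[OF z s t _ f l]
      skew_comp_incl[OF w y skew_defined_points(6)[OF _ t] g _ h] skew_incl_closed[OF y h] w y
    by (auto simp: skew_comp_hom_eq skew_comp_zero_left)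
  have rhs: "?rhs = (if skew_defined t g z x \<and> skew_defined s ?tg w x
      then skew_incl w x (gcomp G s ?tg) ?R else \<zero>\<^bsub>skew_hom C G A w x\<^esub>)"
    using skew_comp_incl[OF z y t g l h] skew_prod_closed[OF y t g _ l h]
      skew_comp_incl[OF w z s skew_defined_points(6)[OF _ g] f] skew_incl_closed[OF w f] w z
    by (auto simp: skew_comp_hom_eq skew_comp_zero_right)
  show ?thesis
  proof (cases "composable G s t \<and> composable G t g \<and> w \<in> ob_dom A s
      \<and> x \<in> ob_dom A (ginv G (gcomp G ?st g))")
    case False
    then show ?thesis
      unfolding lhs rhs
      using composable_assoc comp_assoc by (auto simp: skew_defined_def)
  next
    case True
    then have c: "composable G s t" "composable G t g" and ws: "w \<in> ob_dom A s"
      and xk: "x \<in> ob_dom A (ginv G (gcomp G ?st g))" by auto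
    have c': "composable G ?st g" "composable G s ?tg" using composable_assoc c by auto
    have st: "?st \<in> mor G" and assoc: "gcomp G s ?tg = gcomp G ?st g"
      using comp_mor[OF c(1)] comp_assoc[OF c] by simp_all
    define w' where "w' = ob_act A (ginv G s) w"
    define f' where "f' = act A (ginv G s) w (ob_act A s z) f"
    define m where "m = Comp C w' z ?p f' l"
    have si: "ginv G s \<in> mor G" and ti: "ginv G t \<in> mor G" using mor by (auto simp: ginv_simps)
    have w'_dom: "w' \<in> ob_dom A (ginv G s)" "w' \<in> Obj C" "ob_act A s w' = w"
      using point_inv_in_dom[OF mor(1) ws] ob_in_Obj[OF si] point_cancel_inv[OF mor(1) ws]
      by (auto simp: w'_def)
    have pq: "?p \<in> ob_dom A t" "?q \<in> ob_dom A g" "?p \<in> Obj C" "?q \<in> Obj C"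
      using star_act_in_dom star_act_in_Obj t g by auto
    have f': "f' \<in> Idl A (ginv G s) w' z"
      using act_ginv_closed[OF mor(1) ws star_act_in_dom[OF s] f] point_inv_cancel[OF mor(1) dom(1)]
      by (simp add: f'_def w'_def)
    have f't: "f' \<in> Idl A (tgt G t) w' z"
      using Idl_subset_tgt[OF si w'_dom(2) z f'] mor c by (simp add: ginv_simps composable_def)
    have ht: "h \<in> Idl A (src G t) y ?q"
      using Idl_subset_tgt[OF mor(3) y pq(4) h] c by (simp add: composable_def)
    have mt: "m \<in> Idl A t w' ?p"
      unfolding m_def by (rule Idl_comp_left[OF mor(2) w'_dom(2) z pq(3) f't l])
    have ms: "m \<in> Idl A (ginv G s) w' ?p"
      unfolding m_def using Idl_comp_right[OF si w'_dom(2) z pq(3) f'] Idl_subset_tgt[OF mor(2) z pq(3) l]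
        c mor by (simp add: ginv_simps composable_def)
    have iff1: "y \<in> ob_dom A (ginv G ?st) \<longleftrightarrow> ?p \<in> ob_dom A (ginv G s)"
      using point_in_dom_iff[OF c(1) dom(2)] by simp
    have iff2: "w \<in> ob_dom A ?st \<longleftrightarrow> w' \<in> ob_dom A t"
      using point_inv_in_dom_iff[OF c(1) ws] by (simp add: w'_def)
    have iff3: "x \<in> ob_dom A (ginv G ?tg) \<longleftrightarrow> ?q \<in> ob_dom A (ginv G t)"
      using point_in_dom_iff[OF c(2) dom(3)] by simp
    have q_st: "?q \<in> ob_dom A (ginv G ?st)"
      using point_in_dom_iff[OF c'(1) dom(3)] xk by simp
    have dL: "skew_defined s t w y \<and> skew_defined ?st g w x
        \<longleftrightarrow> ?p \<in> ob_dom A (ginv G s) \<and> w' \<in> ob_dom A t"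
      using c c' ws xk iff1 iff2 by (auto simp: skew_defined_def)
    have dR: "skew_defined t g z x \<and> skew_defined s ?tg w x \<longleftrightarrow> ?q \<in> ob_dom A (ginv G t)"
      using c c' ws xk iff3 zt assoc by (auto simp: skew_defined_def)
    \<comment> \<open>The left product is obtained from \<open>m\<close> by pulling back along \<open>t\<close>, composing with \<open>h\<close>, and
      acting with the composite.\<close>
    let ?w'' = "ob_act A (ginv G t) w'"
    let ?n = "Comp C ?w'' y ?q (act A (ginv G t) w' ?p m) h"
    have L: "?L = act A ?st ?w'' ?q ?n \<and> ?n \<in> Idl A (ginv G t) ?w'' ?q
        \<and> ?w'' \<in> ob_dom A (ginv G t) \<and> ?w'' \<in> ob_dom A (ginv G ?st)"
      if L: "?p \<in> ob_dom A (ginv G s)" "w' \<in> ob_dom A t"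
    proof -
      have d: "skew_defined s t w y" and wst: "w \<in> ob_dom A ?st" using dL L iff2 by auto
      have w'': "?w'' = ob_act A (ginv G ?st) w"
        using point_comp[OF composable_ginv_ginv[OF c(1)], of w] ws L(2) mor ginv_gcomp[OF c(1)]
        by (simp add: w'_def ginv_ginv)
      have w''_dom: "?w'' \<in> ob_dom A (ginv G t)" using point_inv_in_dom mor L by simp
      have "act A (ginv G t) w' ?p m \<in> Idl A (ginv G t) ?w'' y"
        using act_ginv_closed[OF mor(2) L(2) pq(1) mt] point_inv_cancel[OF mor(2) dom(2)] by simp
      then have "?n \<in> Idl A (ginv G t) ?w'' ?q"
        using Idl_comp_right[OF ti ob_in_Obj[OF ti w''_dom] y pq(4)] ht mor by (simp add: ginv_simps)
      moreover have "?L = act A ?st ?w'' ?q ?n"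
        using act_ginv_composite_skew_prod[OF y t z s d wst f l] w''
        by (simp add: skew_prod_def[of ?st] m_def f'_def w'_def)
      ultimately show ?thesis
        using w'' w''_dom point_inv_in_dom[OF st wst] by simp
    qed
    \<comment> \<open>The right product is the action of \<open>s\<close> on the same transported product, by the associativity
      of the ideal at \<open>t\<close>.\<close>
    have R: "?R = act A s w' (ob_act A t ?q) (conj_right t y ?q h w' m)
        \<and> conj_right t y ?q h w' m = Comp C w' z (ob_act A t ?q) f' (skew_prod t z y ?q l h)
        \<and> ob_act A ?tg x = ob_act A t ?q \<and> ob_act A t ?q \<in> ob_dom A (ginv G s)
        \<and> skew_prod t z y ?q l h \<in> Idl A t z (ob_act A t ?q)"
      if R: "?q \<in> ob_dom A (ginv G t)"
    proof -
      have d: "skew_defined t g z x" using dR R by auto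
      have tq: "ob_act A ?tg x = ob_act A t ?q"
        using skew_defined_points(5)[OF d g] by simp
      have eq: "conj_right t y ?q h w' m
          = Comp C w' z (ob_act A t ?q) f' (skew_prod t z y ?q l h)"
        unfolding m_def skew_prod_conj_right[OF zt]
        by (rule conj_right_comp[OF LR[OF mor(2)] mor(2) w'_dom(2) z dom(2) R f't l ht])
      have sq: "ob_act A t ?q \<in> ob_dom A (ginv G s)"
        using point_in_dom_iff[OF c(1) R] q_st by simp
      have "skew_prod t z y ?q l h \<in> Idl A t z (ob_act A t ?q)"
      proof -
        note p = skew_defined_points[OF d g]
        show ?thesis
          using act_closed[OF p(1,8,3) skew_prod_inner_closed(2)[OF y t g d l h]] p(9)
          by (simp add: skew_prod_def)
      qed
      then show ?thesis
        using eq tq sq by (simp add: skew_prod_def[of s] w'_def f'_def)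
    qed
    consider (both) "?p \<in> ob_dom A (ginv G s)" "w' \<in> ob_dom A t" "?q \<in> ob_dom A (ginv G t)"
      | (left) "?p \<in> ob_dom A (ginv G s)" "w' \<in> ob_dom A t" "?q \<notin> ob_dom A (ginv G t)"
      | (right) "?p \<notin> ob_dom A (ginv G s) \<or> w' \<notin> ob_dom A t" "?q \<in> ob_dom A (ginv G t)"
      | (none) "?p \<notin> ob_dom A (ginv G s) \<or> w' \<notin> ob_dom A t" "?q \<notin> ob_dom A (ginv G t)"
      by blast
    then show ?thesis
    proof cases
      case both
      note L = L[OF both(1,2)] and R = R[OF both(3)]
      let ?r = "ob_act A t ?q"
      have r: "?r \<in> ob_dom A t" "?r \<in> Obj C"
        using point_in_dom[OF mor(2) both(3)] ob_in_Obj[OF mor(2)] by auto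
      have n: "conj_right t y ?q h w' m = act A t ?w'' ?q ?n"
        using both by (simp add: conj_right_def)
      have nt: "act A t ?w'' ?q ?n \<in> Idl A t w' ?r"
        using act_closed[OF mor(2) _ both(3)] L point_cancel_inv[OF mor(2) both(2)] by fastforce
      \<comment> \<open>Membership in the ideal at the inverse of \<open>s\<close> comes from the other form of the product,
        whose left factor is \<open>f'\<close>.\<close>
      have "conj_right t y ?q h w' m \<in> Idl A (ginv G s) w' ?r"
        using R Idl_comp_right[OF si w'_dom(2) z r(2) f'] Idl_subset_tgt[OF mor(2) z r(2)] c mor
        by (simp add: ginv_simps composable_def)
      then have ns: "act A t ?w'' ?q ?n \<in> Idl A (ginv G s) w' ?r" using n by simp
      have "?n = act A (ginv G t) w' ?r (act A t ?w'' ?q ?n)"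
        using ginv_act_act[OF mor(2) both(3), of ?w'' ?n] L point_cancel_inv[OF mor(2) both(2)] by simp
      then have "?n \<in> act A (ginv G t) w' ?r ` (Idl A t w' ?r \<inter> Idl A (ginv G s) w' ?r)"
        using nt ns by blast
      then have "act A s w' ?r (act A t ?w'' ?q ?n) = act A ?st ?w'' ?q ?n"
        using act_comp[OF c(1), of ?r w' ?w'' ?q ?n] r(1) R both w'_dom point_inv_cancel[OF mor(2) both(3)]
        by simp
      then have "?R = ?L"
        using conjunct1[OF L] conjunct1[OF R] unfolding n by (metis (lifting))
      then show ?thesis unfolding lhs rhs using dL dR both assoc by simp
    next
      case left
      note L = L[OF left(1,2)]
      \<comment> \<open>The source of \<open>?n\<close> is \<open>?q\<close>, where the ideal at the inverse of \<open>t\<close> is zero.\<close>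
      have "?n = \<zero>\<^bsub>Hom C ?w'' ?q\<^esub>"
        using L left Idl_vanish[OF ti ob_in_Obj[OF ti] pq(4)] by blast
      then have "?L = \<zero>\<^bsub>Hom C (ob_act A ?st ?w'') (ob_act A ?st ?q)\<^esub>"
        using L act_zero[OF st _ q_st] by simp
      moreover have "ob_act A ?st ?w'' = w"
        using point_comp[OF c(1)] L point_cancel_inv[OF mor(2) left(2)] w'_dom by metis
      moreover have "ob_act A ?st ?q = ob_act A (gcomp G ?st g) x"
        using point_comp[OF c'(1) dom(3) q_st] .
      ultimately show ?thesis
        unfolding lhs rhs using dL dR left skew_incl_zero by auto
    next
      case right
      note R = R[OF right(2)]
      let ?r = "ob_act A t ?q"
      interpret conj: entry_multiplier R "ideal_semicat C A t" ?p ?r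
          "conj_left t y ?q h" "conj_right t y ?q h"
        by (rule conjugated_entry_multiplier[OF mor(2) dom(2) right(2) ht])
      \<comment> \<open>If \<open>?p\<close> is the object outside its domain, then the associativity of the ideal at \<open>t\<close> is
        needed as well: \<open>?p\<close> is neither source nor target in \<open>f' (t (t\<^sup>-\<^sup>1 l h))\<close>, but moving \<open>f'\<close> next
        to \<open>l\<close> makes it the source of \<open>m\<close>, which is therefore zero.\<close>
      have "conj_right t y ?q h w' m = \<zero>\<^bsub>Hom C w' ?r\<^esub>"
      proof (cases "w' \<in> ob_dom A t")
        case True
        then have "m = \<zero>\<^bsub>Hom C w' ?p\<^esub>"
          using right Idl_vanish[OF si w'_dom(2) pq(3) ms] by blast
        then show ?thesis using conj.rho_zero[of w'] w'_dom by simp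
      qed (simp add: conj_right_def)
      then have "?R = \<zero>\<^bsub>Hom C w (ob_act A s ?r)\<^esub>"
        using R act_zero[OF mor(1) w'_dom(1), of ?r] w'_dom(3) by (metis (lifting))
      moreover have "ob_act A s ?r = ob_act A (gcomp G s ?tg) x"
        using point_comp[OF c'(2), of x] R right(2) iff3 by simp
      ultimately show ?thesis
        unfolding lhs rhs using dL dR right skew_incl_zero by auto
    next
      case none
      then show ?thesis unfolding lhs rhs using dL dR by auto
    qed
  qed
qed

lemma skew_comp_assoc:
  assumes LR: "\<And>g. g \<in> mor G \<Longrightarrow> LR_associative (ideal_semicat C A g)"
    and w: "w \<in> Obj C" and z: "z \<in> Obj C" and y: "y \<in> Obj C" and x: "x \<in> Obj C"
    and f: "f \<in> carrier (skew_hom C G A w z)" and l: "l \<in> carrier (skew_hom C G A z y)"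
    and h: "h \<in> carrier (skew_hom C G A y x)"
  shows "skew_comp w y x (skew_comp w z y f l) h = skew_comp w z x f (skew_comp z y x l h)"
proof -
  note closed = skew_comp_closed and zeros = skew_comp_zero_left skew_comp_zero_right
    and adds = skew_comp_add_left skew_comp_add_right
  have step1: "skew_comp w y x (skew_comp w z y (skew_incl w z s f) (skew_incl z y t l)) h
      = skew_comp w z x (skew_incl w z s f) (skew_comp z y x (skew_incl z y t l) h)"
    if s: "s \<in> star G A z" and f: "f \<in> Idl A s w (ob_act A s z)"
      and t: "t \<in> star G A y" and l: "l \<in> Idl A t z (ob_act A t y)" for s t f l
    using h[unfolded skew_hom_def]
  proof (induction rule: direct_sum_induct)
    case (groups g)
    then show ?case using summand_group y by simp
  next
    case zero
    show ?case
      unfolding skew_hom_def[symmetric]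
      using skew_incl_closed[OF w f] skew_incl_closed[OF z l] w z y by (simp add: zeros closed)
  next
    case (incl g h)
    then show ?case using skew_comp_assoc_homogeneous[OF LR w z y x s t _ f l] by simp
  next
    case (add h h')
    then show ?case
      unfolding skew_hom_def[symmetric]
      using skew_incl_closed[OF w f] skew_incl_closed[OF z l] w z y by (simp add: adds closed)
  qed
  have step2: "skew_comp w y x (skew_comp w z y (skew_incl w z s f) l) h
      = skew_comp w z x (skew_incl w z s f) (skew_comp z y x l h)"
    if s: "s \<in> star G A z" and f: "f \<in> Idl A s w (ob_act A s z)" for s f
    using l[unfolded skew_hom_def]
  proof (induction rule: direct_sum_induct)
    case (groups t)
    then show ?case using summand_group z by simp
  next
    case zero
    show ?case
      unfolding skew_hom_def[symmetric]
      using skew_incl_closed[OF w f] h w z y by (simp add: zeros closed)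
  next
    case (incl t l)
    then show ?case using step1[OF s f] by simp
  next
    case (add l l')
    then show ?case
      unfolding skew_hom_def[symmetric]
      using skew_incl_closed[OF w f] h w z y by (simp add: adds closed)
  qed
  show ?thesis
    using f[unfolded skew_hom_def]
  proof (induction rule: direct_sum_induct)
    case (groups t)
    then show ?case using summand_group w by simp
  next
    case zero
    show ?case
      unfolding skew_hom_def[symmetric] using l h w z y by (simp add: zeros closed)
  next
    case (incl s f)
    then show ?case using step2 by simp
  next
    case (add f f')
    then show ?case
      unfolding skew_hom_def[symmetric] using l h w z y by (simp add: adds closed)
  qed
qed

end

theorem proposition4p8:
  fixes R :: "'r ring" and C :: "('r, 'm, 'o) semicat_data"
    and G :: "'g cat_data" and A :: "('m, 'o, 'g) pact_data"
  assumes "cring R"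
    and "groupoid G"
    and "r_semicategory R C"
    and "partial_action_semicat R C G A"
    and "\<And>g. g \<in> mor G \<Longrightarrow> LR_associative (ideal_semicat C A g)"
  shows "semicat_associative (skew_semicat C G A)"
proof -
  interpret partial_action_semicat R C G A by fact
  show ?thesis
    unfolding semicat_associative_def
    using skew_comp_assoc[OF assms(5)] by (simp add: skew_semicat_def)
qed

end
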